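(* Let $1\le r\le\infty$, let $f$ be a holomorphic function in a neighbourhood of the closed unit polydisc $\overline{\mathbb{D}^n}$ in $\mathbb{C}^n$, and set $Z=f^{-1}(0)$. If $\omega$ is a $(0,n)$-form with coefficient in $L^{r}_{c}(\mathbb{D}^n\setminus Z)$, then for every $k\in\mathbb{N}$ there is a $(0,n-1)$-form $\eta$ with coefficients in $L^{r}(\mathbb{D}^n)$ such that $f^{-k}\eta$ has coefficients in $L^{r}(\mathbb{D}^n)$, all the coefficients of $\eta$ but at most one are in $L^{r}_c(\mathbb{D}^n\setminus Z)$, and $\bar\partial\eta=\omega$.
   Context: $\mathbb{D}$ is the open unit disc in $\mathbb{C}$ and $\mathbb{D}^n$ the open unit polydisc in $\mathbb{C}^n$. For an open set $U$, $L^r_c(U)$ denotes the space of functions in $L^r$ with compact support contained in $U$. The coefficients of a $(0,n-1)$-form $\eta$ are the functions $\eta_j$ in $\eta=\sum_{j=1}^n\eta_j\, d\hat{\bar z}_j$, where $d\hat{\bar z}_j$ is the exterior product, in increasing order, of all $d\bar z_i$ with $i\ne j$. The operator $\bar\partial$ is taken in the sense of distributions. *)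

theory Defs
  imports "HOL-Analysis.Analysis"
begin

definition unit_polydisc :: "(complex ^ 'n::finite) set" where
  "unit_polydisc = {z. \<forall>j. norm (z $ j) < 1}"

text \<open>Holomorphy in several variables: complex differentiability at each point, i.e. the real
  derivative exists and is complex linear. Only used for open sets.\<close>

definition holomorphic_multi :: "(complex ^ 'n::finite \<Rightarrow> complex) \<Rightarrow> (complex ^ 'n) set \<Rightarrow> bool" where
  "holomorphic_multi f U \<longleftrightarrow>
     (\<forall>z\<in>U. \<exists>D. (f has_derivative D) (at z) \<and> (\<forall>c v. D (c *s v) = c * D v))"

definition Lr :: "ennreal \<Rightarrow> 'a::euclidean_space set \<Rightarrow> ('a \<Rightarrow> complex) \<Rightarrow> bool" where
  "Lr r U u \<longleftrightarrow>
     u \<in> borel_measurable (lebesgue_on U) \<and>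
     (if r = \<infinity> then \<exists>C. AE x in lebesgue_on U. norm (u x) \<le> C
      else integrable (lebesgue_on U) (\<lambda>x. norm (u x) powr enn2real r))"

text \<open>The support of a class of functions modulo null sets: the complement of the largest open set
  on which the function vanishes almost everywhere.\<close>

definition ess_support :: "('a::euclidean_space \<Rightarrow> complex) \<Rightarrow> 'a set" where
  "ess_support u = {x. \<forall>V. open V \<and> x \<in> V \<longrightarrow> \<not> (AE y in lebesgue. y \<in> V \<longrightarrow> u y = 0)}"

text \<open>Elements of \<open>L\<^sup>r\<^sub>c(U)\<close> are identified with their extension by zero to the whole space.\<close>

definition Lrc :: "ennreal \<Rightarrow> 'a::euclidean_space set \<Rightarrow> ('a \<Rightarrow> complex) \<Rightarrow> bool" where
  "Lrc r U u \<longleftrightarrow> Lr r UNIV u \<and> compact (ess_support u) \<and> ess_support u \<subseteq> U"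

primrec C_k :: "nat \<Rightarrow> ('a::real_normed_vector \<Rightarrow> 'b::real_normed_vector) \<Rightarrow> bool" where
  "C_k 0 u \<longleftrightarrow> continuous_on UNIV u"
| "C_k (Suc k) u \<longleftrightarrow>
     (\<forall>x. u differentiable (at x)) \<and> (\<forall>v. C_k k (\<lambda>x. frechet_derivative u (at x) v))"

definition test_functions :: "'a::euclidean_space set \<Rightarrow> ('a \<Rightarrow> complex) set" where
  "test_functions U =
     {\<phi>. (\<forall>k. C_k k \<phi>) \<and> compact (closure {x. \<phi> x \<noteq> 0}) \<and> closure {x. \<phi> x \<noteq> 0} \<subseteq> U}"

text \<open>\<open>\<partial>/\<partial>z\<^sub>j-bar = (\<partial>/\<partial>x\<^sub>j + \<i> \<partial>/\<partial>y\<^sub>j) / 2\<close>\<close>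

definition dzbar :: "'n \<Rightarrow> (complex ^ 'n::finite \<Rightarrow> complex) \<Rightarrow> complex ^ 'n \<Rightarrow> complex" where
  "dzbar j \<phi> z =
     (frechet_derivative \<phi> (at z) (axis j 1) + \<i> * frechet_derivative \<phi> (at z) (axis j \<i>)) / 2"

definition distr_of :: "'a::euclidean_space set \<Rightarrow> ('a \<Rightarrow> complex) \<Rightarrow> ('a \<Rightarrow> complex) \<Rightarrow> complex" where
  "distr_of U u \<phi> = (LINT z|lebesgue_on U. u z * \<phi> z)"

definition distr_dzbar ::
  "'n \<Rightarrow> ((complex ^ 'n::finite \<Rightarrow> complex) \<Rightarrow> complex) \<Rightarrow> (complex ^ 'n \<Rightarrow> complex) \<Rightarrow> complex" where
  "distr_dzbar j T \<phi> = - T (dzbar j \<phi>)"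

text \<open>A \<open>(0,n-1)\<close>-form is given by its coefficients \<open>\<eta> j\<close>, where \<open>\<eta> j\<close> belongs to the increasing
  product of all \<open>dz\<^sub>i-bar\<close> with \<open>i \<noteq> j\<close>; a \<open>(0,n)\<close>-form is given by its coefficient \<open>\<omega>\<close> with respect
  to the increasing product of all \<open>dz\<^sub>i-bar\<close>. Moving \<open>dz\<^sub>j-bar\<close> to its place in the product
  contributes one sign for every \<open>i < j\<close>.\<close>

definition dbar ::
  "(complex, 'n) vec set \<Rightarrow>
   ('n::{finite,linorder} \<Rightarrow> (complex, 'n) vec \<Rightarrow> complex) \<Rightarrow>
   ((complex, 'n) vec \<Rightarrow> complex) \<Rightarrow> complex" where
  "dbar U \<eta> \<phi> = (\<Sum>j\<in>UNIV. (-1) ^ card {i. i < j} * distr_dzbar j (distr_of U (\<eta> j)) \<phi>)"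

definition dbar_eq ::
  "(complex, 'n) vec set \<Rightarrow>
   ('n::{finite,linorder} \<Rightarrow> (complex, 'n) vec \<Rightarrow> complex) \<Rightarrow>
   ((complex, 'n) vec \<Rightarrow> complex) \<Rightarrow> bool" where
  "dbar_eq U \<eta> \<omega> \<longleftrightarrow> (\<forall>\<phi>\<in>test_functions U. dbar U \<eta> \<phi> = distr_of U \<omega> \<phi>)"

end

theory Submission
  imports Defs "HOL-Complex_Analysis.Cauchy_Integral_Formula" "HOL-Probability.Sinc_Integral"
begin

text \<open>
  Since the support of \<open>\<omega>\<close> is a compact set avoiding the zeros of \<open>f\<close>, the form \<open>f\<^sup>-\<^sup>k \<omega>\<close> is again in
  \<open>L\<^sup>r\<close> with compact support. Let \<open>T\<close> be its Cauchy transform in the first variable alone,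
  the other variables being parameters. By Jensen's inequality and Fubini's theorem \<open>T\<close> is in \<open>L\<^sup>r\<close>,
  and the derivative of \<open>T\<close> with respect to the conjugate of the first variable is \<open>f\<^sup>-\<^sup>k \<omega>\<close>. As \<open>f\<close> is
  holomorphic, the form \<open>\<eta>\<close> whose only nonzero coefficient is \<open>\<eta>\<^sub>1 = f\<^sup>k T\<close> solves the equation.

  The one-variable Cauchy-Pompeiu formula is obtained by integrating by parts against
  \<open>w-bar / (\<bar>w\<bar>\<^sup>2 + \<epsilon>\<^sup>2)\<close>, whose derivative with respect to \<open>w-bar\<close> is the approximate identity
  \<open>\<epsilon>\<^sup>2 / (\<bar>w\<bar>\<^sup>2 + \<epsilon>\<^sup>2)\<^sup>2\<close>.
\<close>

subsection \<open>Integration by parts for compactly supported functions\<close>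

lemma integral_lborel_translate:
  fixes f :: "'a::euclidean_space \<Rightarrow> 'b::{banach, second_countable_topology}"
  assumes "f \<in> borel_measurable borel"
  shows "(LINT x|lborel. f (a + x)) = (LINT x|lborel. f x)"
proof -
  have "(LINT x|distr lborel borel ((+) a). f x) = (LINT x|lborel. f (a + x))"
    using assms by (intro integral_distr) auto
  then show ?thesis by (simp add: lborel_distr_plus)
qed

lemma integrable_lborel_translate:
  fixes f :: "'a::euclidean_space \<Rightarrow> 'b::{banach, second_countable_topology}"
  assumes "integrable lborel f"
  shows "integrable lborel (\<lambda>x. f (a + x))"
proof -
  have "integrable (distr lborel borel ((+) a)) f \<longleftrightarrow> integrable lborel (\<lambda>x. f (a + x))"
    using assms by (intro integrable_distr_eq) (auto dest: borel_measurable_integrable)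
  then show ?thesis using assms by (simp add: lborel_distr_plus)
qed

lemma has_derivative_eq_0_outside_support:
  fixes v :: "'a::real_normed_vector \<Rightarrow> 'b::real_normed_vector"
  assumes "(v has_derivative D) (at x)" and "closed S" and "x \<notin> S" and "\<And>y. y \<notin> S \<Longrightarrow> v y = 0"
  shows "D h = 0"
proof -
  have "((\<lambda>_. 0) has_derivative D) (at x)"
    using assms by (intro has_derivative_transform_within_open[OF assms(1), of "- S"]) auto
  then have "D = (\<lambda>_. 0)"
    using has_derivative_unique has_derivative_const by blast
  then show ?thesis by simp
qed

lemma bounded_of_continuous_compact_support:
  fixes u :: "'a::topological_space \<Rightarrow> 'b::real_normed_vector"
  assumes "continuous_on S u" and "compact S" and "\<And>x. x \<notin> S \<Longrightarrow> u x = 0"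
  obtains B where "0 \<le> B" and "\<And>x. norm (u x) \<le> B"
proof -
  have "bounded (u ` S)"
    using assms compact_continuous_image compact_imp_bounded by blast
  then obtain B where "\<And>y. y \<in> u ` S \<Longrightarrow> norm y \<le> B"
    by (auto simp: bounded_iff)
  then have "norm (u x) \<le> max B 0" for x
    using assms(3)[of x] by (cases "x \<in> S") fastforce+
  then show thesis by (intro that[of "max B 0"]) auto
qed

lemma integrable_lborel_const_indicator:
  fixes S :: "'a::euclidean_space set" and C :: real
  assumes "S \<in> sets borel" and "bounded S"
  shows "integrable lborel (\<lambda>x. C * indicator S x)"
  using assms emeasure_bounded_finite[of S]
  by (intro integrable_mult_right integrable_real_indicator) auto

lemma integrable_continuous_compact_support:
  fixes u :: "'a::euclidean_space \<Rightarrow> 'b::{banach, second_countable_topology}"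
  assumes "continuous_on UNIV u" and "compact S" and "\<And>x. x \<notin> S \<Longrightarrow> u x = 0"
  shows "integrable lborel u"
proof -
  have "integrable lborel (\<lambda>x. indicator S x *\<^sub>R u x)"
    using assms by (intro borel_integrable_compact) (auto intro: continuous_on_subset)
  moreover have "(\<lambda>x. indicator S x *\<^sub>R u x) = u"
    using assms(3) by (auto simp: indicator_def fun_eq_iff)
  ultimately show ?thesis by simp
qed

text \<open>The directional derivative is the pointwise limit of difference quotients along
  \<open>e\<close>. Each of them integrates to zero because Lebesgue measure is translation
  invariant, and the mean value inequality supplies the dominating function.\<close>

lemma integral_directional_derivative_eq_0:
  fixes v :: "'a::euclidean_space \<Rightarrow> 'b::euclidean_space"
  assumes der: "\<And>x. (v has_derivative v' x) (at x)"
    and cont: "continuous_on UNIV (\<lambda>x. v' x e)"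
    and supp: "\<And>x. x \<notin> cball 0 R \<Longrightarrow> v x = 0"
  shows "(LINT x|lborel. v' x e) = 0"
proof -
  have z: "v' x e = 0" if "x \<notin> cball 0 R" for x
    using has_derivative_eq_0_outside_support[OF der closed_cball that supp] by simp
  obtain B where B0: "0 \<le> B" and B: "\<And>x. norm (v' x e) \<le> B"
    using bounded_of_continuous_compact_support[of "cball 0 R" "\<lambda>x. v' x e"] z cont
      continuous_on_subset compact_cball by (metis subset_UNIV)
  have contv: "continuous_on UNIV v"
    using der by (meson has_derivative_continuous continuous_at_imp_continuous_on)
  then have mv [measurable]: "v \<in> borel_measurable borel" by (rule borel_measurable_continuous_onI)
  have mv' [measurable]: "(\<lambda>x. v' x e) \<in> borel_measurable borel"
    using cont by (rule borel_measurable_continuous_onI)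
  have intv: "integrable lborel v"
    by (rule integrable_continuous_compact_support[OF contv compact_cball supp])
  \<comment> \<open>Increments of size at most 1 keep the support of every difference quotient
    inside the ball of radius \<open>R + norm e\<close>.\<close>
  define h where "h m = inverse (real (Suc m))" for m
  have h0: "h m > 0" "h m \<le> 1" for m by (auto simp: h_def field_simps)
  have hlim: "h \<longlonglongrightarrow> 0" unfolding h_def by (rule LIMSEQ_inverse_real_of_nat)
  define q where "q m x = (v (h m *\<^sub>R e + x) - v x) /\<^sub>R h m" for m x
  have "(\<lambda>m. LINT x|lborel. q m x) \<longlonglongrightarrow> (LINT x|lborel. v' x e)"
  proof (rule integral_dominated_convergence)
    show "q m \<in> borel_measurable lborel" for m unfolding q_def by measurable
    show "integrable lborel (\<lambda>x. B * indicator (cball 0 (R + norm e)) x :: real)"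
      by (rule integrable_lborel_const_indicator) auto
    show "AE x in lborel. (\<lambda>m. q m x) \<longlonglongrightarrow> v' x e"
    proof (rule AE_I2)
      fix x
      have "((\<lambda>t. v (t *\<^sub>R e + x)) has_derivative (\<lambda>t. v' (0 *\<^sub>R e + x) (t *\<^sub>R e))) (at 0)"
        by (rule has_derivative_compose[of _ _ _ _ v, OF _ der]) (auto intro!: derivative_eq_intros)
      then have "((\<lambda>t. norm (v (t *\<^sub>R e + x) - v x - v' x (t *\<^sub>R e)) / norm t) \<longlongrightarrow> 0) (at 0)"
        by (simp add: has_derivative_at)
      moreover have "filterlim h (at 0) sequentially"
        using hlim h0 by (auto simp: filterlim_at less_imp_neq[symmetric] intro!: always_eventually) 
      ultimately have "(\<lambda>m. norm (v (h m *\<^sub>R e + x) - v x - v' x (h m *\<^sub>R e)) / norm (h m)) \<longlonglongrightarrow> 0"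
        by (rule filterlim_compose)
      moreover have "norm (v (h m *\<^sub>R e + x) - v x - v' x (h m *\<^sub>R e)) / norm (h m) = norm (q m x - v' x e)" for m
      proof -
        have "q m x - v' x e = (v (h m *\<^sub>R e + x) - v x - v' x (h m *\<^sub>R e)) /\<^sub>R h m"
          using h0[of m] has_derivative_linear[OF der[of x]]
          by (simp add: q_def linear_scale algebra_simps)
        then show ?thesis using h0[of m] by (simp add: divide_inverse)
      qed
      ultimately show "(\<lambda>m. q m x) \<longlonglongrightarrow> v' x e"
        by (simp add: LIM_zero_iff tendsto_norm_zero_iff)
    qed
    show "AE x in lborel. norm (q m x) \<le> B * indicator (cball 0 (R + norm e)) x" for m
    proof (rule AE_I2)
      fix x
      show "norm (q m x) \<le> B * indicator (cball 0 (R + norm e)) x"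
      proof (cases "x \<in> cball 0 (R + norm e)")
        case True
        have "norm (v (h m *\<^sub>R e + x) - v (0 *\<^sub>R e + x)) \<le> B * norm (h m - 0)"
        proof (rule differentiable_bound[where S = UNIV and f = "\<lambda>t. v (t *\<^sub>R e + x)" and f' = "\<lambda>t s. v' (t *\<^sub>R e + x) (s *\<^sub>R e)"])
          fix t :: real
          show "((\<lambda>t. v (t *\<^sub>R e + x)) has_derivative (\<lambda>s. v' (t *\<^sub>R e + x) (s *\<^sub>R e))) (at t)"
            by (rule has_derivative_compose[of _ _ _ _ v, OF _ der]) (auto intro!: derivative_eq_intros)
          show "onorm (\<lambda>s. v' (t *\<^sub>R e + x) (s *\<^sub>R e)) \<le> B"
          proof (rule onorm_bound[OF B0])
            fix s :: real
            show "norm (v' (t *\<^sub>R e + x) (s *\<^sub>R e)) \<le> B * norm s"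
              using B[of "t *\<^sub>R e + x"] has_derivative_linear[OF der[of "t *\<^sub>R e + x"]]
              by (simp add: linear_scale mult.commute[of B] mult_left_mono)
          qed
        qed auto
        then show ?thesis using True h0[of m] by (simp add: q_def divide_inverse_commute[symmetric] pos_divide_le_eq)
      next
        case False
        have "norm (h m *\<^sub>R e) \<le> norm e"
          using h0[of m] by (simp add: mult_left_le_one_le)
        moreover have "norm x \<le> norm (h m *\<^sub>R e + x) + norm (h m *\<^sub>R e)"
          by (metis add_diff_cancel_left' norm_triangle_ineq4 add.commute)
        ultimately have "norm (h m *\<^sub>R e + x) > R" using False by simp
        moreover have "norm x > R" using False norm_ge_zero[of e] by (simp del: norm_ge_zero)
        ultimately have "q m x = 0" unfolding q_def by (simp add: supp)
        then show ?thesis using B0 by simp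
      qed
    qed
  qed auto
  moreover have "(LINT x|lborel. q m x) = 0" for m
    using intv integrable_lborel_translate[OF intv, of "h m *\<^sub>R e"] integral_lborel_translate[OF mv, of "h m *\<^sub>R e"]
    unfolding q_def by simp
  ultimately show ?thesis by (simp add: LIMSEQ_const_iff)
qed

text \<open>It is enough to compare boxes, whose preimages are boxes with the same side lengths.
  Through this identity the integrability of products on \<open>real \<times> real\<close> carries
  over to the complex plane.\<close>

lemma lborel_complex_eq_distr:
  "(lborel :: complex measure) = distr (lborel :: (real \<times> real) measure) borel (\<lambda>(x, y). Complex x y)"
proof (rule lborel_eqI)
  have m [measurable]: "(\<lambda>(x, y). Complex x y) \<in> borel_measurable (borel :: (real \<times> real) measure)"
    by (intro borel_measurable_continuous_onI) (auto simp: case_prod_beta complex_eq_iff intro!: continuous_intros)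
  fix l u :: complex
  assume le: "\<And>b. b \<in> Basis \<Longrightarrow> l \<bullet> b \<le> u \<bullet> b"
  have "(\<lambda>(x, y). Complex x y) -` box l u = box (Re l, Im l) (Re u, Im u)"
    by (auto simp: box_def Basis_complex_def Basis_prod_def)
  moreover have "Re l \<le> Re u" "Im l \<le> Im u" using le[of 1] le[of \<i>] by (auto simp: Basis_complex_def)
  ultimately show "emeasure (distr lborel borel (\<lambda>(x, y). Complex x y)) (box l u) = ennreal (\<Prod>b\<in>Basis. (u - l) \<bullet> b)"
    by (subst emeasure_distr)
      (auto simp: emeasure_lborel_box_eq Basis_complex_def Basis_prod_def inner_complex_def prod.union_disjoint
         prod.reindex)
qed auto

subsection \<open>The Cauchy kernel\<close>

lemma integral_lborel_scale:
  fixes f :: "'a::euclidean_space \<Rightarrow> 'b::{banach, second_countable_topology}"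
  assumes [measurable]: "f \<in> borel_measurable borel" and "c \<noteq> 0"
  shows "(LINT x|lborel. f x) = \<bar>c\<bar> ^ DIM('a) *\<^sub>R (LINT x|lborel. f (c *\<^sub>R x))"
proof -
  have "(LINT x|lborel. f x) =
      (LINT x|density (distr lborel borel (\<lambda>x. 0 + c *\<^sub>R x)) (\<lambda>_. ennreal (\<bar>c\<bar> ^ DIM('a))). f x)"
    using lborel_affine[OF assms(2), where t = "0::'a"] by simp
  also have "\<dots> = (LINT x|distr lborel borel (\<lambda>x. 0 + c *\<^sub>R x). (\<bar>c\<bar> ^ DIM('a)) *\<^sub>R f x)"
    by (rule integral_density) auto
  also have "\<dots> = (LINT x|lborel. (\<bar>c\<bar> ^ DIM('a)) *\<^sub>R f (0 + c *\<^sub>R x))"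
    by (rule integral_distr) auto
  finally show ?thesis by simp
qed

lemma integrable_pair_mult:
  fixes f :: "'a \<Rightarrow> 'c::{real_normed_field, banach, second_countable_topology}" and g :: "'b \<Rightarrow> 'c"
  assumes "sigma_finite_measure M" and "sigma_finite_measure N" and f: "integrable M f" and g: "integrable N g"
  shows "integrable (M \<Otimes>\<^sub>M N) (\<lambda>(x, y). f x * g y)"
proof -
  interpret pair_sigma_finite M N using assms by (intro pair_sigma_finite.intro)
  have [measurable]: "f \<in> borel_measurable M" "g \<in> borel_measurable N" using f g by auto
  show ?thesis
    by (rule Fubini_integrable) (use f g in \<open>auto simp: norm_mult\<close>)
qed

lemma integrable_lborel_complex_mult:
  fixes f g :: "real \<Rightarrow> real"
  assumes "integrable lborel f" and "integrable lborel g"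
  shows "integrable (lborel :: complex measure) (\<lambda>w. f (Re w) * g (Im w))"
proof -
  have [measurable]: "f \<in> borel_measurable borel" "g \<in> borel_measurable borel" using assms by auto
  have [measurable]: "(\<lambda>(x, y). Complex x y) \<in> borel_measurable (borel :: (real \<times> real) measure)"
    by (intro borel_measurable_continuous_onI) (auto simp: case_prod_beta complex_eq_iff intro!: continuous_intros)
  have "integrable (lborel :: (real \<times> real) measure) (\<lambda>(x, y). f x * g y)"
    using integrable_pair_mult[OF sigma_finite_lborel sigma_finite_lborel assms] by (simp add: lborel_prod)
  then show ?thesis
    by (subst lborel_complex_eq_distr, subst integrable_distr_eq) (measurable, simp add: case_prod_unfold)
qed

text \<open>With \<open>a\<close> and \<open>b\<close> the squares of the real and imaginary parts,
  \<open>(1 + a) * (1 + b) \<le> (1 + (a + b))\<^sup>2\<close> gives a bound by a product of two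
  integrable functions of one variable.\<close>

lemma integrable_inverse_square_1_plus_norm_square:
  "integrable (lborel :: complex measure) (\<lambda>w. 1 / (1 + (norm w)\<^sup>2)\<^sup>2)"
proof (rule Bochner_Integration.integrable_bound)
  have "integrable lborel (\<lambda>x::real. inverse (1 + x\<^sup>2))"
    using integrable_inverse_1_plus_square by (simp add: set_integrable_def)
  then show "integrable (lborel :: complex measure) (\<lambda>w. inverse (1 + (Re w)\<^sup>2) * inverse (1 + (Im w)\<^sup>2))"
    by (rule integrable_lborel_complex_mult) fact
  show "AE w in lborel. norm (1 / (1 + (norm w)\<^sup>2)\<^sup>2) \<le> norm (inverse (1 + (Re w)\<^sup>2) * inverse (1 + (Im w)\<^sup>2))"
  proof (rule AE_I2)
    fix w :: complex
    have "(1 + a) * (1 + b) \<le> (1 + (a + b))\<^sup>2" if "0 \<le> a" "0 \<le> b" for a b :: real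
      using that by (simp add: power2_eq_square algebra_simps)
    then have "(1 + (Re w)\<^sup>2) * (1 + (Im w)\<^sup>2) \<le> (1 + (norm w)\<^sup>2)\<^sup>2"
      unfolding cmod_power2 by simp
    moreover have "0 < (1 + (Re w)\<^sup>2) * (1 + (Im w)\<^sup>2)"
      by (intro mult_pos_pos) (auto simp: add_pos_nonneg)
    ultimately have "1 / (1 + (norm w)\<^sup>2)\<^sup>2 \<le> 1 / ((1 + (Re w)\<^sup>2) * (1 + (Im w)\<^sup>2))"
      by (intro frac_le) auto
    then show "norm (1 / (1 + (norm w)\<^sup>2)\<^sup>2) \<le> norm (inverse (1 + (Re w)\<^sup>2) * inverse (1 + (Im w)\<^sup>2))"
      by (simp add: abs_mult inverse_eq_divide)
  qed
qed auto

text \<open>The kernel is cut off at the diameter of the disc, which makes it integrable and loses nothing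
  for functions on the polydisc. Division by zero gives it the value 0 at the origin.\<close>

definition cauchy_kernel :: "complex \<Rightarrow> complex" where
  "cauchy_kernel w = indicator (cball 0 2) w / w"

lemma cauchy_kernel_measurable [measurable]: "cauchy_kernel \<in> borel_measurable borel"
  unfolding cauchy_kernel_def by (intro borel_measurable_divide borel_measurable_indicator) auto

lemma integrable_abs_powr_minus_half:
  "integrable lborel (\<lambda>x::real. indicator {-2..2} x * \<bar>x\<bar> powr (-1/2))"
proof -
  have "(\<lambda>x::real. x powr (-1/2)) absolutely_integrable_on {0..2}"
    by (intro nonnegative_absolutely_integrable_1 integrable_on_powr_from_0) auto
  then have *: "integrable lborel (\<lambda>x::real. indicator {0..2} x * x powr (-1/2))"
    unfolding set_integrable_def by (subst (asm) integrable_completion) auto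
  \<comment> \<open>The reflected function covers the negative side; \<open>0 + -1 * x\<close> is
    the affine shape required by the change of variables.\<close>
  have "integrable lborel (\<lambda>x::real. indicator {0..2} (0 + -1 * x) * (0 + -1 * x) powr (-1/2))"
    by (subst lborel_integrable_real_affine_iff) (use * in auto)
  from Bochner_Integration.integrable_add[OF * this] show ?thesis
    by (rule Bochner_Integration.integrable_bound) (auto simp: indicator_def)
qed

text \<open>Local integrability in the plane is reduced to one variable by \<open>\<bar>x\<bar> \<bar>y\<bar> \<le> \<bar>x + \<i> y\<bar>\<^sup>2\<close>.\<close>

lemma integrable_cauchy_kernel: "integrable lborel cauchy_kernel"
proof (rule Bochner_Integration.integrable_bound)
  let ?h = "\<lambda>x::real. indicator {-2..2} x * \<bar>x\<bar> powr (-1/2)"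
  show "integrable (lborel :: complex measure) (\<lambda>w. ?h (Re w) * ?h (Im w))"
    by (intro integrable_lborel_complex_mult integrable_abs_powr_minus_half)
  \<comment> \<open>The axes are discarded because \<open>0 powr (-1/2)\<close> is 0, so that the
    product bound fails there; they form a null set.\<close>
  have ae: "AE w in (lborel :: complex measure). Re w \<noteq> 0 \<and> Im w \<noteq> 0"
  proof -
    have "negligible {w::complex. Re w = 0}" "negligible {w::complex. Im w = 0}"
      using negligible_standard_hyperplane[of "1::complex" 0] negligible_standard_hyperplane[of "\<i>::complex" 0]
      by (auto simp: Basis_complex_def)
    then have "AE w in lebesgue. w \<notin> {w::complex. Re w = 0}" "AE w in lebesgue. w \<notin> {w::complex. Im w = 0}"
      by (auto simp only: negligible_iff_null_sets intro: AE_not_in)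
    then show ?thesis unfolding AE_completion_iff by eventually_elim auto
  qed
  show "AE w in lborel. norm (cauchy_kernel w) \<le> norm (?h (Re w) * ?h (Im w))"
    using ae
  proof eventually_elim
    case (elim w)
    show ?case
    proof (cases "norm w \<le> 2")
      case True
      then have r: "Re w \<in> {-2..2}" "Im w \<in> {-2..2}"
        using abs_Re_le_cmod[of w] abs_Im_le_cmod[of w] by auto
      have "0 \<le> (\<bar>Re w\<bar> - \<bar>Im w\<bar>)\<^sup>2" by simp
      then have "\<bar>Re w\<bar> * \<bar>Im w\<bar> * 2 \<le> (norm w)\<^sup>2"
        by (simp add: cmod_power2 power2_diff)
      then have "\<bar>Re w\<bar> * \<bar>Im w\<bar> \<le> (norm w)\<^sup>2"
        by (smt (verit) mult_nonneg_nonneg abs_ge_zero)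
      then have "sqrt (\<bar>Re w\<bar> * \<bar>Im w\<bar>) \<le> norm w"
        by (rule real_le_lsqrt[rotated -1]) auto
      then have "1 / norm w \<le> 1 / (sqrt \<bar>Re w\<bar> * sqrt \<bar>Im w\<bar>)"
        using elim by (intro divide_left_mono) (auto simp: real_sqrt_mult intro!: mult_pos_pos)
      then show ?thesis using True r elim
        by (simp add: cauchy_kernel_def norm_divide powr_minus powr_half_sqrt inverse_eq_divide abs_mult)
    qed (simp add: cauchy_kernel_def)
  qed
qed auto

text \<open>This is \<open>\<pi>\<close>, but only its being nonzero matters: it normalises the fundamental solution.\<close>

definition cauchy_const :: real where
  "cauchy_const = (LINT w|(lborel :: complex measure). 1 / (1 + (norm w)\<^sup>2)\<^sup>2)"

text \<open>A nonnegative function with zero integral vanishes almost everywhere, whereas this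
  integrand is positive everywhere.\<close>

lemma cauchy_const_nonzero: "cauchy_const \<noteq> 0"
proof
  assume "cauchy_const = 0"
  then have "AE w in (lborel :: complex measure). 1 / (1 + (norm w)\<^sup>2)\<^sup>2 = 0"
    unfolding cauchy_const_def
    by (subst (asm) integral_nonneg_eq_0_iff_AE[OF integrable_inverse_square_1_plus_norm_square]) auto
  then have "AE w in (lborel :: complex measure). False"
    by eventually_elim (simp add: add_nonneg_eq_0_iff)
  then show False
    by (simp add: ae_filter_eq_bot_iff eventually_False)
qed

subsection \<open>The Cauchy-Pompeiu formula\<close>

text \<open>Adding \<open>s\<close> to the denominator of \<open>cnj w / (w * cnj w)\<close>, which
  is \<open>1 / w\<close> off the origin, removes the singularity. By the quotient rule the
  derivative with respect to the conjugate variable is \<open>1 / d - w * cnj w / d\<^sup>2\<close>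
  with \<open>d = w * cnj w + of_real s\<close>, and \<open>d - w * cnj w\<close> reduces to
  \<open>s\<close>.\<close>

lemma dbar_regularised_kernel:
  fixes s :: real
  assumes "s > 0"
  defines "k \<equiv> \<lambda>w::complex. cnj w / (w * cnj w + of_real s)"
    and "k' \<equiv> \<lambda>w h::complex. cnj h / (w * cnj w + of_real s)
                - cnj w * (h * cnj w + w * cnj h) / (w * cnj w + of_real s)\<^sup>2"
  shows "(k has_derivative k' w) (at w)"
    and "continuous_on UNIV (\<lambda>w. k' w h)"
    and "(k' w 1 + \<i> * k' w \<i>) / 2 = of_real (s / ((norm w)\<^sup>2 + s)\<^sup>2)"
proof -
  have d: "w * cnj w + of_real s = of_real ((norm w)\<^sup>2 + s)" for w :: complex
    by (simp add: complex_norm_square[symmetric])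
  have nz: "w * cnj w + of_real s \<noteq> 0" for w :: complex
    unfolding d of_real_eq_0_iff using assms(1) by (smt (verit) zero_le_power2)
  have cnj: "(cnj has_derivative cnj) F" for F
    by (intro bounded_linear_imp_has_derivative bounded_linear_cnj)
  show "(k has_derivative k' w) (at w)"
  proof -
    define d where "d = w * cnj w + of_real s"
    have "((\<lambda>w. w * cnj w + of_real s) has_derivative (\<lambda>h. h * cnj w + w * cnj h)) (at w)"
      by (auto intro!: derivative_eq_intros cnj)
    from has_derivative_divide'[OF cnj this nz[of w]]
    have "(k has_derivative (\<lambda>h. (cnj h * d - cnj w * (h * cnj w + w * cnj h)) / (d * d))) (at w)"
      unfolding k_def d_def .
    moreover have "(cnj h * d - cnj w * (h * cnj w + w * cnj h)) / (d * d) = k' w h" for h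
      unfolding k'_def d_def[symmetric] using nz[of w, folded d_def]
      by (simp add: diff_divide_distrib power2_eq_square)
    ultimately show ?thesis by simp
  qed
  show "continuous_on UNIV (\<lambda>w. k' w h)"
    unfolding k'_def using nz by (intro continuous_intros) auto
  have "k' w 1 + \<i> * k' w \<i> = 2 * of_real s / (w * cnj w + of_real s)\<^sup>2"
  proof -
    define d where "d = w * cnj w + of_real s"
    \<comment> \<open>The terms linear in \<open>h\<close> cancel since
      \<open>1 + \<i> * \<i> = 0\<close>, and those in \<open>cnj h\<close> double since
      \<open>\<i> * cnj \<i> = 1\<close>.\<close>
    have "k' w 1 + \<i> * k' w \<i> = 2 / d - 2 * (w * cnj w) / d\<^sup>2"
      unfolding k'_def d_def[symmetric]
      by (simp add: algebra_simps add_divide_distrib diff_divide_distrib)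
    also have "\<dots> = 2 * (d - w * cnj w) / d\<^sup>2"
      using nz[of w, folded d_def] by (simp add: field_simps power2_eq_square)
    finally show ?thesis unfolding d_def by simp
  qed
  also have "\<dots> = 2 * of_real (s / ((norm w)\<^sup>2 + s)\<^sup>2)"
    unfolding d by simp
  finally show "(k' w 1 + \<i> * k' w \<i>) / 2 = of_real (s / ((norm w)\<^sup>2 + s)\<^sup>2)"
    by simp
qed

text \<open>The product of \<open>u\<close> with the regularised kernel has compact support, so its
  derivatives integrate to zero and the product rule moves the derivative from \<open>u\<close> to
  the kernel. Rescaling \<open>w\<close> by \<open>\<epsilon>\<close> then leaves a fixed weight,
  with \<open>\<epsilon>\<close> only in the argument of \<open>u\<close>.\<close>

lemma integral_dbar_regularised_kernel:
  fixes u :: "complex \<Rightarrow> complex" and \<epsilon> :: real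
  assumes "\<epsilon> > 0"
    and der: "\<And>w. (u has_derivative u' w) (at w)"
    and cont: "\<And>h. continuous_on UNIV (\<lambda>w. u' w h)"
    and supp: "\<And>w. w \<notin> cball 0 R \<Longrightarrow> u w = 0"
  shows "(LINT w|lborel. (u' w 1 + \<i> * u' w \<i>) / 2 * (cnj w / (w * cnj w + of_real (\<epsilon>\<^sup>2)))) =
    - (LINT w|lborel. u (\<epsilon> *\<^sub>R w) * of_real (1 / (1 + (norm w)\<^sup>2)\<^sup>2))"
proof -
  define s where "s = \<epsilon>\<^sup>2"
  have s: "s > 0" using assms(1) by (simp add: s_def)
  define k where "k = (\<lambda>w::complex. cnj w / (w * cnj w + of_real s))"
  define k' where "k' = (\<lambda>w h::complex. cnj h / (w * cnj w + of_real s)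
                - cnj w * (h * cnj w + w * cnj h) / (w * cnj w + of_real s)\<^sup>2)"
  have k: "(k has_derivative k' w) (at w)" "continuous_on UNIV (\<lambda>w. k' w h)"
    "(k' w 1 + \<i> * k' w \<i>) / 2 = of_real (s / ((norm w)\<^sup>2 + s)\<^sup>2)" for w h
    unfolding k_def k'_def by (rule dbar_regularised_kernel[OF s])+
  define v' where "v' w h = u w * k' w h + u' w h * k w" for w h
  have v: "((\<lambda>w. u w * k w) has_derivative v' w) (at w)" for w
    unfolding v'_def using has_derivative_mult[OF der k(1)] by simp
  have cu: "continuous_on UNIV u"
    using der by (meson has_derivative_continuous continuous_at_imp_continuous_on)
  have ck: "continuous_on UNIV k"
    using k(1) by (meson has_derivative_continuous continuous_at_imp_continuous_on)
  have cv: "continuous_on UNIV (\<lambda>w. v' w h)" for h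
    unfolding v'_def by (intro continuous_intros cu ck k cont)
  have u'0: "u' w h = 0" if "w \<notin> cball 0 R" for w h
    using has_derivative_eq_0_outside_support[OF der closed_cball that supp] by simp
  have v'0: "v' w h = 0" if "w \<notin> cball 0 R" for w h
    using that supp u'0 by (simp add: v'_def)
  have iv: "integrable lborel (\<lambda>w. v' w h)" for h
    by (rule integrable_continuous_compact_support[OF cv compact_cball v'0])
  have "(LINT w|lborel. v' w h) = 0" for h
    by (rule integral_directional_derivative_eq_0[OF v cv]) (use supp in auto)
  then have "(LINT w|lborel. (v' w 1 + \<i> * v' w \<i>) / 2) = 0"
    using iv by simp
  moreover have "(v' w 1 + \<i> * v' w \<i>) / 2 =
      (u' w 1 + \<i> * u' w \<i>) / 2 * k w + u w * of_real (s / ((norm w)\<^sup>2 + s)\<^sup>2)" for w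
    unfolding k(3)[symmetric] v'_def by (simp add: algebra_simps add_divide_distrib)
  moreover have "integrable lborel (\<lambda>w. (u' w 1 + \<i> * u' w \<i>) / 2 * k w)"
    by (rule integrable_continuous_compact_support[OF _ compact_cball[of 0 R]])
      (auto intro!: continuous_intros cont ck simp: u'0)
  moreover have cE: "continuous_on UNIV (\<lambda>w. u w * of_real (s / ((norm w)\<^sup>2 + s)\<^sup>2))"
    using s by (intro continuous_intros cu) (auto simp: add_nonneg_eq_0_iff)
  moreover have "integrable lborel (\<lambda>w. u w * of_real (s / ((norm w)\<^sup>2 + s)\<^sup>2))"
    by (rule integrable_continuous_compact_support[OF cE compact_cball[of 0 R]]) (use supp in auto)
  ultimately have "(LINT w|lborel. (u' w 1 + \<i> * u' w \<i>) / 2 * k w) =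
      - (LINT w|lborel. u w * of_real (s / ((norm w)\<^sup>2 + s)\<^sup>2))"
    by (simp add: add_eq_0_iff2)
  \<comment> \<open>The Jacobian of the rescaling is \<open>\<epsilon>\<^sup>2\<close> because the
    plane has real dimension 2.\<close>
  also have "(LINT w|lborel. u w * of_real (s / ((norm w)\<^sup>2 + s)\<^sup>2)) =
      \<epsilon>\<^sup>2 *\<^sub>R (LINT w|lborel. u (\<epsilon> *\<^sub>R w) * of_real (s / ((norm (\<epsilon> *\<^sub>R w))\<^sup>2 + s)\<^sup>2))"
    using integral_lborel_scale[OF borel_measurable_continuous_onI[OF cE], of \<epsilon>] assms(1) by simp
  also have "\<dots> = (LINT w|lborel. \<epsilon>\<^sup>2 *\<^sub>R (u (\<epsilon> *\<^sub>R w) * of_real (s / ((norm (\<epsilon> *\<^sub>R w))\<^sup>2 + s)\<^sup>2)))"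
    by (rule integral_scaleR_right[symmetric]) 
  also have "\<dots> = (LINT w|lborel. u (\<epsilon> *\<^sub>R w) * of_real (1 / (1 + (norm w)\<^sup>2)\<^sup>2))"
  proof (rule Bochner_Integration.integral_cong[OF refl])
    fix w :: complex
    have "(norm (\<epsilon> *\<^sub>R w))\<^sup>2 + s = \<epsilon>\<^sup>2 * (1 + (norm w)\<^sup>2)"
      by (simp add: s_def power_mult_distrib algebra_simps)
    then have "\<epsilon>\<^sup>2 * (s / ((norm (\<epsilon> *\<^sub>R w))\<^sup>2 + s)\<^sup>2) = 1 / (1 + (norm w)\<^sup>2)\<^sup>2"
      using assms(1) by (simp add: s_def power_mult_distrib power2_eq_square)
    moreover have "\<epsilon>\<^sup>2 *\<^sub>R (a * of_real b) = a * of_real (\<epsilon>\<^sup>2 * b)" for a :: complex and b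
      by (simp add: scaleR_conv_of_real)
    ultimately show "\<epsilon>\<^sup>2 *\<^sub>R (u (\<epsilon> *\<^sub>R w) * of_real (s / ((norm (\<epsilon> *\<^sub>R w))\<^sup>2 + s)\<^sup>2)) =
        u (\<epsilon> *\<^sub>R w) * of_real (1 / (1 + (norm w)\<^sup>2)\<^sup>2)"
      by (simp only:)
  qed
  finally show ?thesis unfolding k_def s_def .
qed

text \<open>This is the limit of the regularised identity as \<open>\<epsilon>\<close> tends to 0.
  Both sides converge by dominated convergence: on the left the regularised kernel is bounded by
  \<open>1 / norm w\<close>, on the right \<open>u\<close> is bounded and the weight is integrable.
  The radius 2 of the support matches the cutoff of \<open>cauchy_kernel\<close>.\<close>

lemma cauchy_pompeiu_compact_support:
  fixes u :: "complex \<Rightarrow> complex"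
  assumes der: "\<And>w. (u has_derivative u' w) (at w)"
    and cont: "\<And>h. continuous_on UNIV (\<lambda>w. u' w h)"
    and supp: "\<And>w. w \<notin> cball 0 2 \<Longrightarrow> u w = 0"
  shows "(LINT w|lborel. (u' w 1 + \<i> * u' w \<i>) / 2 * cauchy_kernel w) = - (of_real cauchy_const * u 0)"
proof -
  define D where "D w = (u' w 1 + \<i> * u' w \<i>) / 2" for w
  have cu: "continuous_on UNIV u"
    using der by (meson has_derivative_continuous continuous_at_imp_continuous_on)
  have cD: "continuous_on UNIV D"
    unfolding D_def by (intro continuous_intros cont) auto
  have D0: "D w = 0" if "w \<notin> cball 0 2" for w
    using has_derivative_eq_0_outside_support[OF der closed_cball that supp] by (simp add: D_def)
  obtain B where B: "0 \<le> B" "\<And>w. norm (D w) \<le> B"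
    using bounded_of_continuous_compact_support[OF continuous_on_subset[OF cD subset_UNIV] compact_cball D0] by metis
  obtain C where C: "0 \<le> C" "\<And>w. norm (u w) \<le> C"
    using bounded_of_continuous_compact_support[OF continuous_on_subset[OF cu subset_UNIV] compact_cball supp] by metis
  have [measurable]: "D \<in> borel_measurable borel" "u \<in> borel_measurable borel"
    by (rule borel_measurable_continuous_onI, fact)+
  define h where "h m = inverse (real (Suc m))" for m
  have h0: "h m > 0" for m by (auto simp: h_def)
  have hlim: "h \<longlonglongrightarrow> 0" unfolding h_def by (rule LIMSEQ_inverse_real_of_nat)
  have ne: "w * cnj w + (of_real (h m))\<^sup>2 \<noteq> 0" for w m
  proof -
    have "w * cnj w + (of_real (h m))\<^sup>2 = of_real ((norm w)\<^sup>2 + (h m)\<^sup>2)"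
      by (simp add: complex_norm_square[symmetric])
    then show ?thesis using h0[of m] by (metis of_real_eq_0_iff sum_power2_eq_zero_iff less_irrefl)
  qed
  let ?k = "\<lambda>m w. cnj w / (w * cnj w + of_real ((h m)\<^sup>2))"
  have "(\<lambda>m. LINT w|lborel. D w * ?k m w) \<longlonglongrightarrow> (LINT w|lborel. D w * cauchy_kernel w)"
  proof (rule integral_dominated_convergence)
    show "(\<lambda>w. D w * ?k m w) \<in> borel_measurable lborel" for m
      using ne unfolding measurable_lborel2
      by (intro borel_measurable_continuous_onI continuous_intros cD) auto
    show "integrable lborel (\<lambda>w. B * norm (cauchy_kernel w))"
      using integrable_cauchy_kernel by auto
    show "AE w in lborel. (\<lambda>m. D w * ?k m w) \<longlonglongrightarrow> D w * cauchy_kernel w"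
    proof (rule AE_I2)
      fix w
      show "(\<lambda>m. D w * ?k m w) \<longlonglongrightarrow> D w * cauchy_kernel w"
      \<comment> \<open>At the origin both kernels are 0, the true one by the convention on
        division; outside the ball the factor \<open>D w\<close> vanishes.\<close>
      proof (cases "w = 0 \<or> w \<notin> cball 0 2")
        case True
        then show ?thesis using D0 by (auto simp: cauchy_kernel_def)
      next
        case False
        have "(\<lambda>m. D w * ?k m w) \<longlonglongrightarrow> D w * (cnj w / (w * cnj w + of_real (0\<^sup>2)))"
          using False by (intro tendsto_intros hlim) auto
        then show ?thesis using False by (simp add: cauchy_kernel_def)
      qed
    qed
    show "AE w in lborel. norm (D w * ?k m w) \<le> B * norm (cauchy_kernel w)" for m
    proof (rule AE_I2)
      fix w
      show "norm (D w * ?k m w) \<le> B * norm (cauchy_kernel w)"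
      proof (cases "w = 0 \<or> w \<notin> cball 0 2")
        case True
        then show ?thesis using D0 by (auto simp: cauchy_kernel_def)
      next
        case False
        have "w * cnj w + of_real ((h m)\<^sup>2) = of_real ((norm w)\<^sup>2 + (h m)\<^sup>2)"
          by (simp add: complex_norm_square[symmetric])
        then have "norm (?k m w) = norm w / ((norm w)\<^sup>2 + (h m)\<^sup>2)"
          by (simp add: norm_divide del: of_real_add)
        also have "\<dots> \<le> norm w / (norm w)\<^sup>2"
          using False by (intro divide_left_mono) (auto intro!: mult_pos_pos add_pos_nonneg)
        also have "\<dots> = norm (cauchy_kernel w)"
          using False by (simp add: cauchy_kernel_def norm_divide power2_eq_square)
        finally show ?thesis
          unfolding norm_mult using B by (intro mult_mono) auto
      qed
    qed
  qed auto
  moreover have "(\<lambda>m. - (LINT w|lborel. u (h m *\<^sub>R w) * of_real (1 / (1 + (norm w)\<^sup>2)\<^sup>2))) \<longlonglongrightarrow>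
      - (LINT w|lborel. u (0 *\<^sub>R w) * of_real (1 / (1 + (norm w)\<^sup>2)\<^sup>2))"
  proof (rule tendsto_minus, rule integral_dominated_convergence)
    show "integrable lborel (\<lambda>w::complex. C * (1 / (1 + (norm w)\<^sup>2)\<^sup>2))"
      by (intro integrable_mult_right integrable_inverse_square_1_plus_norm_square)
    show "AE w in lborel. (\<lambda>m. u (h m *\<^sub>R w) * of_real (1 / (1 + (norm w)\<^sup>2)\<^sup>2)) \<longlonglongrightarrow>
        u (0 *\<^sub>R w) * of_real (1 / (1 + (norm w)\<^sup>2)\<^sup>2)"
      using cu by (intro AE_I2 tendsto_mult tendsto_const continuous_on_tendsto_compose[OF cu] tendsto_scaleR hlim) auto
    show "AE w in lborel. norm (u (h m *\<^sub>R w) * of_real (1 / (1 + (norm w)\<^sup>2)\<^sup>2)) \<le> C * (1 / (1 + (norm w)\<^sup>2)\<^sup>2)" for m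
      unfolding norm_mult norm_of_real using C by (intro AE_I2 mult_mono) auto
  qed measurable
  moreover have "(LINT w|lborel. D w * ?k m w) = - (LINT w|lborel. u (h m *\<^sub>R w) * of_real (1 / (1 + (norm w)\<^sup>2)\<^sup>2))" for m
    unfolding D_def by (rule integral_dbar_regularised_kernel[OF h0 der cont supp])
  ultimately have "(LINT w|lborel. D w * cauchy_kernel w) =
      - (LINT w|lborel. u (0 *\<^sub>R w) * of_real (1 / (1 + (norm w)\<^sup>2)\<^sup>2))"
    using LIMSEQ_unique by auto
  also have "(LINT w|lborel. u (0 *\<^sub>R w) * of_real (1 / (1 + (norm w)\<^sup>2)\<^sup>2)) = u 0 * of_real cauchy_const"
    unfolding cauchy_const_def by (simp only: scaleR_zero_left integral_mult_right_zero integral_complex_of_real)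
  finally show ?thesis by (simp add: D_def mult.commute)
qed

subsection \<open>Convolution along a slice\<close>

text \<open>This is convexity: the graph of the \<open>p\<close>-th power lies above its tangent at
  \<open>t\<close>, with the terms rearranged. It follows from Young's inequality for
  \<open>a\<close> and \<open>t powr (p - 1)\<close> with conjugate exponents, which is why
  \<open>p = 1\<close> is treated apart.\<close>

lemma powr_ge_tangent:
  fixes a t p :: real
  assumes "1 \<le> p" and "0 \<le> a" and "0 < t"
  shows "p * t powr (p - 1) * a \<le> a powr p + (p - 1) * t powr p"
proof (cases "p = 1")
  case False
  with assms have p: "p > 1" by simp
  define q where "q = p / (p - 1)"
  have "a * t powr (p - 1) \<le> a powr p / p + (t powr (p - 1)) powr q / q"
    by (rule Youngs_inequality) (use assms p in \<open>auto simp: q_def field_simps\<close>)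
  also have "(t powr (p - 1)) powr q / q = (p - 1) / p * t powr p"
    using p by (simp add: powr_powr q_def)
  finally have "p * (a * t powr (p - 1)) \<le> p * (a powr p / p + (p - 1) / p * t powr p)"
    using p by (intro mult_left_mono) auto
  also have "\<dots> = a powr p + (p - 1) * t powr p"
    using p by (simp add: field_simps)
  finally show ?thesis by (simp add: mult_ac)
qed (use assms in auto)

lemma le_1_plus_powr:
  fixes a p :: real
  assumes "1 \<le> p" and "0 \<le> a"
  shows "a \<le> 1 + a powr p"
proof (cases "a \<le> 1")
  case False
  then have "a powr 1 \<le> a powr p" using assms by (intro powr_mono) auto
  then show ?thesis using False by simp
qed (simp add: add_increasing2)

text \<open>Jensen's inequality for a finite, not necessarily normalised, measure with density \<open>b\<close>.\<close>

lemma powr_weighted_integral_le: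
  fixes a b :: "'a \<Rightarrow> real"
  assumes p: "1 \<le> p" and a: "\<And>x. 0 \<le> a x" and b: "\<And>x. 0 \<le> b x"
    and am [measurable]: "a \<in> borel_measurable M" and ib: "integrable M b"
    and iab: "integrable M (\<lambda>x. a x powr p * b x)"
  shows "integrable M (\<lambda>x. a x * b x)"
    and "(LINT x|M. a x * b x) powr p \<le> (LINT x|M. b x) powr (p - 1) * (LINT x|M. a x powr p * b x)"
proof -
  have bm [measurable]: "b \<in> borel_measurable M" using ib by auto
  show int: "integrable M (\<lambda>x. a x * b x)"
  proof (rule Bochner_Integration.integrable_bound)
    show "integrable M (\<lambda>x. b x + a x powr p * b x)" using ib iab by auto
    have "a x * b x \<le> b x + a x powr p * b x" for x
      using mult_right_mono[OF le_1_plus_powr[OF p a[of x]] b[of x]] by (simp add: algebra_simps)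
    then show "AE x in M. norm (a x * b x) \<le> norm (b x + a x powr p * b x)"
      using a b by (intro AE_I2) (auto intro: order_trans[OF _ abs_ge_self])
  qed auto
  define A where "A = (LINT x|M. a x * b x)"
  define B where "B = (LINT x|M. b x)"
  define I where "I = (LINT x|M. a x powr p * b x)"
  have nn: "A \<ge> 0" "B \<ge> 0" "I \<ge> 0"
    unfolding A_def B_def I_def using a b by (auto intro!: integral_nonneg_AE)
  have "A powr p \<le> B powr (p - 1) * I"
  proof (cases "A = 0")
    case True
    then show ?thesis using nn by simp
  next
    case False
    have "B \<noteq> 0"
    proof
      assume "B = 0"
      then have "AE x in M. b x = 0"
        unfolding B_def using ib b by (subst (asm) integral_nonneg_eq_0_iff_AE) auto
      then have "A = (LINT x|M. 0)" unfolding A_def by (intro integral_cong_AE) auto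
      with False show False by simp
    qed
    with False nn have AB: "A > 0" "B > 0" by auto
    \<comment> \<open>The mean of \<open>a\<close> with respect to the weight \<open>b\<close>.
      Integrating the tangent inequality at this point against \<open>b\<close> yields Jensen's
      inequality.\<close>
    define t where "t = A / B"
    have t: "t > 0" "A = t * B" using AB by (auto simp: t_def)
    have "(LINT x|M. p * t powr (p - 1) * (a x * b x) - (p - 1) * t powr p * b x) \<le> I"
      unfolding I_def
    proof (rule integral_mono)
      fix x
      show "p * t powr (p - 1) * (a x * b x) - (p - 1) * t powr p * b x \<le> a x powr p * b x"
        using mult_right_mono[OF powr_ge_tangent[OF p a[of x] t(1)] b[of x]] by (simp add: algebra_simps)
    qed (use int ib iab in auto)
    also have "(LINT x|M. p * t powr (p - 1) * (a x * b x) - (p - 1) * t powr p * b x) =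
        p * t powr (p - 1) * A - (p - 1) * t powr p * B"
      using int ib by (simp add: A_def B_def)
    also have "\<dots> = t powr p * B"
      using t by (simp add: powr_diff field_simps)
    finally have "B powr (p - 1) * (t powr p * B) \<le> B powr (p - 1) * I"
      by (intro mult_left_mono) auto
    moreover have "B powr (p - 1) * (t powr p * B) = A powr p"
      using AB t by (simp add: powr_mult powr_diff)
    ultimately show ?thesis by simp
  qed
  then show "(LINT x|M. a x * b x) powr p \<le> (LINT x|M. b x) powr (p - 1) * (LINT x|M. a x powr p * b x)"
    by (simp add: A_def B_def I_def)
qed

text \<open>Convolution of \<open>g\<close> with the image under \<open>\<iota>\<close> of the
  measure with density \<open>\<kappa>\<close>. For \<open>\<iota> = axis j\<close> that measure
  lives on a complex line, and with \<open>cauchy_kernel\<close> this is, up to the factor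
  \<open>cauchy_const\<close>, the Cauchy transform in the \<open>j\<close>-th variable
  alone.\<close>

definition slice_conv ::
  "('b::euclidean_space \<Rightarrow> 'a::euclidean_space) \<Rightarrow> ('b \<Rightarrow> complex) \<Rightarrow> ('a \<Rightarrow> complex) \<Rightarrow> 'a \<Rightarrow> complex" where
  "slice_conv \<iota> \<kappa> g z = (LINT w|lborel. g (z - \<iota> w) * \<kappa> w)"

context
  fixes \<iota> :: "'b::euclidean_space \<Rightarrow> 'a::euclidean_space"
  assumes \<iota> [measurable]: "\<iota> \<in> borel_measurable borel"
begin

lemma slice_conv_measurable:
  assumes [measurable]: "g \<in> borel_measurable borel" "\<kappa> \<in> borel_measurable borel"
  shows "slice_conv \<iota> \<kappa> g \<in> borel_measurable borel"
proof -
  have "(\<lambda>z. LINT w|lborel. g (z - \<iota> w) * \<kappa> w) \<in> borel_measurable (lborel :: 'a measure)"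
    by (rule lborel.borel_measurable_lebesgue_integral) measurable
  then show ?thesis by (simp add: slice_conv_def[abs_def])
qed

text \<open>Integrating in \<open>z\<close> first, translation invariance makes the inner integral
  of the norm independent of \<open>w\<close>, up to the factor \<open>norm (\<kappa> w)\<close>.
  The type \<open>'c\<close> stays general since \<open>H\<close> is taken both as a complex
  function and as a real power of its norm.\<close>

lemma integrable_slice_conv_pair:
  fixes H :: "'a \<Rightarrow> 'c::{real_normed_field, banach, second_countable_topology}"
  assumes H: "integrable lborel H" and \<kappa>: "integrable lborel \<kappa>"
  shows "integrable (lborel \<Otimes>\<^sub>M lborel) (\<lambda>(z, w). H (z - \<iota> w) * \<kappa> w)"
proof -
  have [measurable]: "H \<in> borel_measurable borel" "\<kappa> \<in> borel_measurable borel" using H \<kappa> by auto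
  have t: "integrable lborel (\<lambda>z. H (z - \<iota> w))" for w
    using integrable_lborel_translate[OF H, of "- \<iota> w"] by simp
  have n: "(LINT z|lborel. norm (H (z - \<iota> w))) = (LINT z|lborel. norm (H z))" for w
    using integral_lborel_translate[of "\<lambda>z. norm (H z)" "- \<iota> w"] by simp
  have "integrable (lborel \<Otimes>\<^sub>M lborel) (\<lambda>(w, z). H (z - \<iota> w) * \<kappa> w)"
    by (rule lborel_pair.Fubini_integrable) (use t \<kappa> in \<open>auto simp: norm_mult n\<close>)
  from lborel_pair.integrable_product_swap[OF this] show ?thesis by (simp add: case_prod_unfold)
qed

text \<open>Young's convolution inequality. Jensen's inequality with weight
  \<open>norm (\<kappa> w)\<close> applies on the slice through almost every \<open>z\<close>,
  namely where Fubini's theorem makes the integrand of \<open>N z\<close> integrable; integrating in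
  \<open>z\<close> finishes the proof.\<close>

lemma integrable_slice_conv_powr:
  fixes p :: real
  assumes p: "1 \<le> p" and [measurable]: "g \<in> borel_measurable borel" and \<kappa>: "integrable lborel \<kappa>"
    and g: "integrable lborel (\<lambda>z. norm (g z) powr p)"
  shows "integrable lborel (\<lambda>z. norm (slice_conv \<iota> \<kappa> g z) powr p)"
proof (rule Bochner_Integration.integrable_bound)
  have [measurable]: "\<kappa> \<in> borel_measurable borel" using \<kappa> by auto
  define M where "M = (LINT w|lborel. norm (\<kappa> w))"
  define N where "N z = (LINT w|lborel. norm (g (z - \<iota> w)) powr p * norm (\<kappa> w))" for z
  have pr: "integrable (lborel \<Otimes>\<^sub>M lborel) (\<lambda>(z, w). norm (g (z - \<iota> w)) powr p * norm (\<kappa> w))"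
    using integrable_slice_conv_pair[OF g integrable_norm[OF \<kappa>]] .
  show "integrable lborel (\<lambda>z. M powr (p - 1) * N z)"
    unfolding N_def using lborel_pair.integrable_fst[OF pr] by simp
  show "AE z in lborel. norm (norm (slice_conv \<iota> \<kappa> g z) powr p) \<le> norm (M powr (p - 1) * N z)"
    using lborel_pair.AE_integrable_fst[OF pr]
  proof eventually_elim
    case (elim z)
    note * = powr_weighted_integral_le[OF p _ _ _ integrable_norm[OF \<kappa>] elim]
    have "norm (slice_conv \<iota> \<kappa> g z) \<le> (LINT w|lborel. norm (g (z - \<iota> w)) * norm (\<kappa> w))"
      unfolding slice_conv_def norm_mult[symmetric] by (rule integral_norm_bound)
    then have "norm (slice_conv \<iota> \<kappa> g z) powr p \<le> (LINT w|lborel. norm (g (z - \<iota> w)) * norm (\<kappa> w)) powr p"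
      using p by (intro powr_mono2) auto
    also have "\<dots> \<le> M powr (p - 1) * N z"
      unfolding M_def N_def by (rule *(2)) auto
    finally show ?case by simp
  qed
  show "(\<lambda>z. norm (slice_conv \<iota> \<kappa> g z) powr p) \<in> borel_measurable lborel"
    using slice_conv_measurable[of g \<kappa>] by measurable
qed

text \<open>The endpoint \<open>r = \<infinity>\<close>. The bound on \<open>g\<close> is asked at
  every point because a null set may contain the whole slice through a given
  \<open>z\<close>.\<close>

lemma norm_slice_conv_le:
  assumes g: "\<And>z. norm (g z) \<le> C" and [measurable]: "g \<in> borel_measurable borel"
    and \<kappa>: "integrable lborel \<kappa>"
  shows "norm (slice_conv \<iota> \<kappa> g z) \<le> C * (LINT w|lborel. norm (\<kappa> w))"
proof -
  have [measurable]: "\<kappa> \<in> borel_measurable borel" using \<kappa> by auto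
  have i: "integrable lborel (\<lambda>w. C * norm (\<kappa> w))" using \<kappa> by auto
  have b: "norm (g (z - \<iota> w) * \<kappa> w) \<le> C * norm (\<kappa> w)" for w
    unfolding norm_mult using g by (intro mult_right_mono) auto
  have "norm (slice_conv \<iota> \<kappa> g z) \<le> (LINT w|lborel. C * norm (\<kappa> w))"
    unfolding slice_conv_def by (rule Bochner_Integration.integral_norm_bound_integral[OF _ i b])
       (auto intro!: Bochner_Integration.integrable_bound[OF i] AE_I2 order_trans[OF b])
  then show ?thesis by simp
qed

text \<open>The convolution is transposed onto \<open>\<Phi>\<close>: exchange the integrals,
  translate \<open>z\<close> by \<open>\<iota> w\<close>, and exchange back. The translation turns
  the minus sign in the argument of \<open>g\<close> into the plus sign in that of
  \<open>\<Phi>\<close>. The two exchanges need separate integrability facts, \<open>i1\<close> and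
  \<open>i2\<close>.\<close>

lemma integral_slice_conv_mult:
  assumes g: "integrable lborel g" and \<kappa>: "integrable lborel \<kappa>"
    and [measurable]: "\<Phi> \<in> borel_measurable borel" and \<Phi>: "\<And>z. norm (\<Phi> z) \<le> C"
  shows "(LINT z|lborel. slice_conv \<iota> \<kappa> g z * \<Phi> z) =
    (LINT z|lborel. g z * (LINT w|lborel. \<Phi> (z + \<iota> w) * \<kappa> w))"
proof -
  have [measurable]: "\<kappa> \<in> borel_measurable borel" "g \<in> borel_measurable borel" using \<kappa> g by auto
  have i1: "integrable (lborel \<Otimes>\<^sub>M lborel) (\<lambda>(z, w). g (z - \<iota> w) * \<kappa> w * \<Phi> z)"
  proof (rule Bochner_Integration.integrable_bound)
    show "integrable (lborel \<Otimes>\<^sub>M lborel) (\<lambda>x. C *\<^sub>R (case x of (z, w) \<Rightarrow> g (z - \<iota> w) * \<kappa> w))"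
      by (intro integrable_scaleR_right integrable_slice_conv_pair g \<kappa>)
    show "AE x in lborel \<Otimes>\<^sub>M lborel. norm (case x of (z, w) \<Rightarrow> g (z - \<iota> w) * \<kappa> w * \<Phi> z) \<le>
        norm (C *\<^sub>R (case x of (z, w) \<Rightarrow> g (z - \<iota> w) * \<kappa> w))"
      using order_trans[OF \<Phi> abs_ge_self]
      by (intro AE_I2) (auto simp: norm_mult mult.commute[of "\<bar>C\<bar>"] intro!: mult_left_mono)
  qed measurable
  have i2: "integrable (lborel \<Otimes>\<^sub>M lborel) (\<lambda>(z, w). g z * (\<Phi> (z + \<iota> w) * \<kappa> w))"
  proof (rule Bochner_Integration.integrable_bound)
    show "integrable (lborel \<Otimes>\<^sub>M lborel) (\<lambda>x. C *\<^sub>R (case x of (z, w) \<Rightarrow> g z * \<kappa> w))"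
      by (intro integrable_scaleR_right integrable_pair_mult g \<kappa> sigma_finite_lborel)
    have "norm a * (norm (\<Phi> z) * norm b) \<le> \<bar>C\<bar> * (norm a * norm b)" for a b z
      using mult_right_mono[of "norm (\<Phi> z)" "\<bar>C\<bar>" "norm a * norm b"] \<Phi>[of z] by (simp add: mult_ac)
    then show "AE x in lborel \<Otimes>\<^sub>M lborel. norm (case x of (z, w) \<Rightarrow> g z * (\<Phi> (z + \<iota> w) * \<kappa> w)) \<le>
        norm (C *\<^sub>R (case x of (z, w) \<Rightarrow> g z * \<kappa> w))"
      by (intro AE_I2) (auto simp: norm_mult)
  qed measurable
  have "(LINT z|lborel. slice_conv \<iota> \<kappa> g z * \<Phi> z) =
      (LINT z|lborel. LINT w|lborel. g (z - \<iota> w) * \<kappa> w * \<Phi> z)"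
    by (simp add: slice_conv_def)
  also have "\<dots> = (LINT w|lborel. LINT z|lborel. g (z - \<iota> w) * \<kappa> w * \<Phi> z)"
    using lborel_pair.Fubini_integral[OF i1] by simp
  also have "\<dots> = (LINT w|lborel. LINT z|lborel. g z * (\<Phi> (z + \<iota> w) * \<kappa> w))"
  proof (rule Bochner_Integration.integral_cong[OF refl])
    fix w
    show "(LINT z|lborel. g (z - \<iota> w) * \<kappa> w * \<Phi> z) = (LINT z|lborel. g z * (\<Phi> (z + \<iota> w) * \<kappa> w))"
      using integral_lborel_translate[of "\<lambda>z. g (z - \<iota> w) * \<kappa> w * \<Phi> z" "\<iota> w"]
      by (simp add: mult_ac add.commute)
  qed
  also have "\<dots> = (LINT z|lborel. LINT w|lborel. g z * (\<Phi> (z + \<iota> w) * \<kappa> w))"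
    using lborel_pair.Fubini_integral[OF i2] by simp
  finally show ?thesis by simp
qed

end

subsection \<open>Lebesgue spaces and essential support\<close>

lemma Lr_dominated:
  fixes u v :: "'a::euclidean_space \<Rightarrow> complex"
  assumes v: "Lr r U v" and u: "u \<in> borel_measurable (lebesgue_on U)" and C: "0 \<le> C"
    and le: "AE x in lebesgue_on U. norm (u x) \<le> C * norm (v x)"
  shows "Lr r U u"
proof (cases "r = \<infinity>")
  case True
  then obtain B where "AE x in lebesgue_on U. norm (v x) \<le> B" using v by (auto simp: Lr_def)
  with le have "AE x in lebesgue_on U. norm (u x) \<le> C * B"
    by eventually_elim (use C in \<open>meson mult_left_mono order_trans\<close>)
  then show ?thesis using True u by (auto simp: Lr_def)
next
  case False
  define p where "p = enn2real r"
  have p: "p \<ge> 0" by (simp add: p_def)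
  have [measurable]: "u \<in> borel_measurable (lebesgue_on U)" by fact
  have "integrable (lebesgue_on U) (\<lambda>x. norm (u x) powr p)"
  proof (rule Bochner_Integration.integrable_bound)
    show "integrable (lebesgue_on U) (\<lambda>x. C powr p * norm (v x) powr p)"
      using v False by (simp add: Lr_def p_def)
    show "AE x in lebesgue_on U. norm (norm (u x) powr p) \<le> norm (C powr p * norm (v x) powr p)"
      using le
    proof eventually_elim
      case (elim x)
      then have "norm (u x) powr p \<le> (C * norm (v x)) powr p" using p by (intro powr_mono2) auto
      then show ?case using C by (simp add: powr_mult)
    qed
  qed measurable
  then show ?thesis using False u by (simp add: Lr_def p_def)
qed

lemma Lr_UNIV:
  "Lr r UNIV u \<longleftrightarrow> u \<in> borel_measurable lebesgue \<and>
    (if r = \<infinity> then \<exists>C. AE x in lebesgue. norm (u x) \<le> C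
     else integrable lebesgue (\<lambda>x. norm (u x) powr enn2real r))"
  unfolding Lr_def lebesgue_on_UNIV_eq ..

lemma Lr_subset:
  fixes u :: "'a::euclidean_space \<Rightarrow> complex"
  assumes "Lr r UNIV u" and U: "U \<in> sets lebesgue"
  shows "Lr r U u"
proof -
  have m: "u \<in> borel_measurable lebesgue" using assms(1) by (simp add: Lr_UNIV)
  then have mU: "u \<in> borel_measurable (lebesgue_on U)" by (rule measurable_restrict_space1)
  show ?thesis
  proof (cases "r = \<infinity>")
    case True
    then obtain B where "AE x in lebesgue. norm (u x) \<le> B"
      using assms(1) by (auto simp: Lr_UNIV)
    then have "AE x in lebesgue_on U. norm (u x) \<le> B"
      using U by (subst AE_restrict_space_iff) auto
    then show ?thesis using True mU by (auto simp: Lr_def)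
  next
    case False
    then have "integrable lebesgue (\<lambda>x. norm (u x) powr enn2real r)"
      using assms(1) by (simp add: Lr_UNIV)
    then have "integrable (lebesgue_on U) (\<lambda>x. norm (u x) powr enn2real r)"
      using integrable_mult_indicator[OF U, of "\<lambda>x. norm (u x) powr enn2real r"] U
      by (subst integrable_restrict_space) simp_all
    then show ?thesis using False mU by (simp add: Lr_def)
  qed
qed

lemma ess_support_zero: "ess_support (\<lambda>_. 0) = {}"
  unfolding ess_support_def by (auto intro!: exI[of _ UNIV])

lemma Lr_zero: "Lr r U (\<lambda>_. 0)"
  by (auto simp: Lr_def intro!: exI[of _ 0])

lemma Lrc_zero: "Lrc r U (\<lambda>_. 0)"
  by (simp add: Lrc_def Lr_zero ess_support_zero)

text \<open>The complement of the support is a possibly uncountable union of open sets on which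
  \<open>u\<close> vanishes almost everywhere. By Lindelof's theorem countably many of them suffice,
  so the exceptional sets add up to a null set.\<close>

lemma AE_eq_0_outside_ess_support:
  fixes u :: "'a::euclidean_space \<Rightarrow> complex"
  shows "AE x in lebesgue. x \<notin> ess_support u \<longrightarrow> u x = 0"
proof -
  define F where "F = {V. open V \<and> (AE y in lebesgue. y \<in> V \<longrightarrow> u y = 0)}"
  have "\<And>V. V \<in> F \<Longrightarrow> open V" by (simp add: F_def)
  then obtain F' where F': "F' \<subseteq> F" "countable F'" "\<Union>F' = \<Union>F" by (rule Lindelof)
  have "AE y in lebesgue. \<forall>V\<in>F'. y \<in> V \<longrightarrow> u y = 0"
    using F' by (subst AE_ball_countable) (auto simp: F_def)
  then show ?thesis
  proof eventually_elim
    case (elim y)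
    show ?case
    proof
      assume "y \<notin> ess_support u"
      then have "y \<in> \<Union>F" by (auto simp: ess_support_def F_def)
      then show "u y = 0" using elim F'(3) by blast
    qed
  qed
qed

text \<open>Slices are null sets, so a convolution along them depends on the chosen representative.
  This one is Borel, as the Fubini arguments require, vanishes at every point off \<open>S\<close>,
  and for \<open>r = \<infinity>\<close> is bounded at every point.\<close>

lemma Lr_compact_support_borel_representative:
  fixes u :: "'a::euclidean_space \<Rightarrow> complex"
  assumes r: "1 \<le> r" and u: "Lr r UNIV u" and S: "compact S" and u0: "AE x in lebesgue. x \<notin> S \<longrightarrow> u x = 0"
  obtains g where "g \<in> borel_measurable borel" and "AE x in lebesgue. g x = u x" and "\<And>x. x \<notin> S \<Longrightarrow> g x = 0"
    and "integrable lborel g"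
    and "if r = \<infinity> then \<exists>C. \<forall>x. norm (g x) \<le> C else integrable lborel (\<lambda>x. norm (g x) powr enn2real r)"
proof -
  have Sb: "S \<in> sets borel" using S by (simp add: compact_imp_closed)
  have [measurable]: "u \<in> borel_measurable lebesgue" using u by (simp add: Lr_UNIV)
  obtain a where a: "a \<in> borel_measurable lborel" "AE x in lborel. Re (u x) = a x"
    using completion_ex_borel_measurable_real[of "\<lambda>x. Re (u x)" lborel] by auto
  obtain b where b: "b \<in> borel_measurable lborel" "AE x in lborel. Im (u x) = b x"
    using completion_ex_borel_measurable_real[of "\<lambda>x. Im (u x)" lborel] by auto
  from a(2) b(2) have aeab: "AE x in lebesgue. u x = Complex (a x) (b x)"
    unfolding AE_completion_iff by (auto simp: complex_eq_iff)
  have [measurable]: "a \<in> borel_measurable borel" "b \<in> borel_measurable borel" using a b by auto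
  define g0 where "g0 x = (if x \<in> S then complex_of_real (a x) + \<i> * of_real (b x) else 0)" for x
  have g0m [measurable]: "g0 \<in> borel_measurable borel"
    unfolding g0_def using Sb by measurable
  have ae0: "AE x in lebesgue. g0 x = u x"
    using aeab u0 by eventually_elim (auto simp: g0_def Complex_eq)
  have int: "integrable lborel h" if [measurable]: "h \<in> borel_measurable borel" and "\<And>x. x \<notin> S \<Longrightarrow> h x = 0"
    and "\<And>x. norm (h x) \<le> C" for h :: "'a \<Rightarrow> complex" and C
  proof (rule Bochner_Integration.integrable_bound)
    show "integrable lborel (\<lambda>x. C * indicator S x)"
      using Sb S compact_imp_bounded by (intro integrable_lborel_const_indicator) auto
    show "AE x in lborel. norm (h x) \<le> norm (C * indicator S x)"
      using that(2,3) order_trans[OF that(3) abs_ge_self] by (intro AE_I2) (auto simp: indicator_def)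
  qed measurable
  show thesis
  proof (cases "r = \<infinity>")
    case True
    then obtain C where C: "AE x in lebesgue. norm (u x) \<le> C"
      using u by (auto simp: Lr_UNIV)
    \<comment> \<open>Truncation at the essential bound changes \<open>g0\<close> only on a null
      set.\<close>
    define g where "g x = (if norm (g0 x) \<le> C then g0 x else 0)" for x
    have gm: "g \<in> borel_measurable borel" unfolding g_def by measurable
    have gC: "norm (g x) \<le> max C 0" for x by (auto simp: g_def)
    show thesis
    proof (rule that[of g])
      show "AE x in lebesgue. g x = u x" using ae0 C by eventually_elim (auto simp: g_def)
      show g0: "g x = 0" if "x \<notin> S" for x using that by (simp add: g_def g0_def)
      show "integrable lborel g" by (rule int[OF gm g0 gC])
      show "if r = \<infinity> then \<exists>C. \<forall>x. norm (g x) \<le> C else integrable lborel (\<lambda>x. norm (g x) powr enn2real r)"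
        using True gC by auto
    qed (rule gm)
  next
    case False
    define p where "p = enn2real r"
    have p: "1 \<le> p" using r False unfolding p_def
      by (metis enn2real_1 enn2real_mono infinity_ennreal_def top.not_eq_extremum)
    have "integrable lebesgue (\<lambda>x. norm (u x) powr p)"
      using u False by (simp add: Lr_UNIV p_def)
    moreover have "(\<lambda>x. norm (g0 x) powr p) \<in> borel_measurable lebesgue"
      by (rule measurable_completion) simp
    moreover have "AE x in lebesgue. norm (u x) powr p = norm (g0 x) powr p"
      using ae0 by eventually_elim simp
    ultimately have "integrable lebesgue (\<lambda>x. norm (g0 x) powr p)"
      by (subst integrable_cong_AE[of _ _ "\<lambda>x. norm (u x) powr p"]) (auto simp: eq_commute)
    then have ip: "integrable lborel (\<lambda>x. norm (g0 x) powr p)"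
      by (subst (asm) integrable_completion) auto
    show thesis
    proof (rule that[of g0])
      show "integrable lborel g0"
      proof (rule Bochner_Integration.integrable_bound)
        \<comment> \<open>On a set of finite measure, integrability of the \<open>p\<close>-th power
          implies integrability, by \<open>t \<le> 1 + t powr p\<close>.\<close>
        show "integrable lborel (\<lambda>x. 1 * indicator S x + norm (g0 x) powr p)"
          using Sb S compact_imp_bounded ip
          by (intro Bochner_Integration.integrable_add integrable_lborel_const_indicator) auto
        show "AE x in lborel. norm (g0 x) \<le> norm (1 * indicator S x + norm (g0 x) powr p)"
          using le_1_plus_powr[OF p norm_ge_zero] by (intro AE_I2) (auto simp: g0_def)
      qed measurable
      show "if r = \<infinity> then \<exists>C. \<forall>x. norm (g0 x) \<le> C else integrable lborel (\<lambda>x. norm (g0 x) powr enn2real r)"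
        using False ip by (simp add: p_def)
    qed (use ae0 g0m in \<open>auto simp: g0_def\<close>)
  qed
qed

lemma Lr_slice_conv:
  fixes \<iota> :: "'b::euclidean_space \<Rightarrow> 'a::euclidean_space"
  assumes r: "1 \<le> r" and \<iota>: "\<iota> \<in> borel_measurable borel" and \<kappa>: "integrable lborel \<kappa>"
    and gm: "g \<in> borel_measurable borel"
    and g: "if r = \<infinity> then \<exists>C. \<forall>x. norm (g x) \<le> C else integrable lborel (\<lambda>x. norm (g x) powr enn2real r)"
  shows "Lr r UNIV (slice_conv \<iota> \<kappa> g)"
proof -
  have m [measurable]: "slice_conv \<iota> \<kappa> g \<in> borel_measurable borel"
    using slice_conv_measurable[OF \<iota> gm] \<kappa> by auto
  show ?thesis
  proof (cases "r = \<infinity>")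
    case True
    then obtain C where "\<And>x. norm (g x) \<le> C" using g by auto
    then have "norm (slice_conv \<iota> \<kappa> g z) \<le> C * (LINT w|lborel. norm (\<kappa> w))" for z
      by (rule norm_slice_conv_le[OF \<iota> _ gm \<kappa>])
    then show ?thesis using True by (auto simp: Lr_UNIV intro!: measurable_completion)
  next
    case False
    define p where "p = enn2real r"
    have p: "1 \<le> p" using r False unfolding p_def
      by (metis enn2real_1 enn2real_mono infinity_ennreal_def top.not_eq_extremum)
    have "integrable lborel (\<lambda>z. norm (slice_conv \<iota> \<kappa> g z) powr p)"
      using integrable_slice_conv_powr[OF \<iota> p gm \<kappa>] g False by (simp add: p_def)
    then have "integrable lebesgue (\<lambda>z. norm (slice_conv \<iota> \<kappa> g z) powr p)"
      by (subst integrable_completion) auto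
    then show ?thesis using False
      by (auto simp: Lr_UNIV p_def intro!: measurable_completion)
  qed
qed

subsection \<open>Restriction to complex lines\<close>

lemma has_derivative_axis:
  fixes z :: "complex ^ 'n"
  shows "((\<lambda>w::complex. z + axis j w) has_derivative (\<lambda>h. axis j h)) F"
proof -
  have "bounded_linear (axis j :: complex \<Rightarrow> complex ^ 'n)"
    by (intro linear_conv_bounded_linear[THEN iffD1] linearI) (auto simp: vec_eq_iff axis_def)
  then show ?thesis by (auto intro!: derivative_eq_intros bounded_linear_imp_has_derivative)
qed

lemma continuous_on_axis: "continuous_on S (\<lambda>w::complex. z + axis j w)"
  by (rule has_derivative_continuous_on[OF has_derivative_axis])

lemma borel_measurable_axis [measurable]:
  "(axis j :: complex \<Rightarrow> complex ^ 'n) \<in> borel_measurable borel"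
  using continuous_on_axis[of UNIV 0 j] by (intro borel_measurable_continuous_onI) simp

lemma holomorphic_multi_continuous_on:
  assumes "holomorphic_multi f \<Omega>"
  shows "continuous_on \<Omega> f"
  using assms unfolding holomorphic_multi_def
  by (meson continuous_at_imp_continuous_on has_derivative_continuous)

lemma holomorphic_multi_slice:
  fixes f :: "complex ^ 'n \<Rightarrow> complex"
  assumes "holomorphic_multi f \<Omega>"
  shows "(\<lambda>w. f (z + axis j w)) holomorphic_on {w. z + axis j w \<in> \<Omega>}"
proof (rule holomorphic_onI)
  fix w assume "w \<in> {w. z + axis j w \<in> \<Omega>}"
  then obtain D where D: "(f has_derivative D) (at (z + axis j w))" "\<And>c v. D (c *s v) = c * D v"
    using assms by (auto simp: holomorphic_multi_def)
  \<comment> \<open>Complex linearity turns the derivative along the axis into multiplication by a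
    complex number, the partial derivative.\<close>
  have "(\<lambda>h. D (axis j h)) = (*) (D (axis j 1))"
  proof
    fix h
    have "axis j h = h *s (axis j 1 :: complex ^ 'n)"
      by (auto simp: vec_eq_iff axis_def)
    then show "D (axis j h) = D (axis j 1) * h"
      using D(2)[of h "axis j 1"] by (simp only: mult.commute)
  qed
  moreover have "((\<lambda>w. f (z + axis j w)) has_derivative (\<lambda>h. D (axis j h))) (at w)"
    by (rule has_derivative_compose[OF has_derivative_axis D(1)])
  ultimately have "((\<lambda>w. f (z + axis j w)) has_field_derivative D (axis j 1)) (at w)"
    by (simp only: has_field_derivative_def)
  then show "(\<lambda>w. f (z + axis j w)) field_differentiable (at w within {w. z + axis j w \<in> \<Omega>})"
    using field_differentiable_at_within field_differentiable_def by blast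
qed

section \<open>Derivatives and supports of test functions\<close>

lemma test_functions_has_derivative:
  assumes "\<phi> \<in> test_functions U"
  shows "(\<phi> has_derivative frechet_derivative \<phi> (at x)) (at x)"
    and "continuous_on UNIV (\<lambda>x. frechet_derivative \<phi> (at x) v)"
proof -
  have "C_k (Suc 0) \<phi>" using assms unfolding test_functions_def by blast
  then show "(\<phi> has_derivative frechet_derivative \<phi> (at x)) (at x)"
    and "continuous_on UNIV (\<lambda>x. frechet_derivative \<phi> (at x) v)"
    by (auto simp: frechet_derivative_works)
qed

lemma test_functions_continuous_on:
  assumes "\<phi> \<in> test_functions U"
  shows "continuous_on S \<phi>"
  using test_functions_has_derivative(1)[OF assms]
  by (meson has_derivative_continuous continuous_at_imp_continuous_on)

lemma test_functions_support:
  assumes "\<phi> \<in> test_functions U"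
  defines "S \<equiv> closure {x. \<phi> x \<noteq> 0}"
  shows "compact S" and "S \<subseteq> U" and "\<And>x. x \<notin> S \<Longrightarrow> \<phi> x = 0"
    and "\<And>x v. x \<notin> S \<Longrightarrow> frechet_derivative \<phi> (at x) v = 0"
proof -
  show "compact S" "S \<subseteq> U" using assms by (auto simp: test_functions_def)
  show *: "\<phi> x = 0" if "x \<notin> S" for x
    using that closure_subset[of "{x. \<phi> x \<noteq> 0}"] by (auto simp: S_def)
  show "frechet_derivative \<phi> (at x) v = 0" if "x \<notin> S" for x v
    by (rule has_derivative_eq_0_outside_support[OF test_functions_has_derivative(1)[OF assms(1)] _ that *])
      (auto simp: S_def)
qed

text \<open>The one-variable formula is applied to \<open>f ^ k * \<phi>\<close> on the complex line
  through \<open>z\<close>; the holomorphic factor passes through the derivative with respect to the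
  conjugate variable. The support condition holds because two points of the unit disc are less than
  2 apart.\<close>

lemma cauchy_pompeiu_slice:
  fixes f :: "complex ^ 'n \<Rightarrow> complex" and k :: nat
  assumes \<Omega>: "open \<Omega>" "unit_polydisc \<subseteq> \<Omega>" and f: "holomorphic_multi f \<Omega>"
    and \<phi>: "\<phi> \<in> test_functions unit_polydisc" and z: "z \<in> unit_polydisc"
  shows "(LINT w|lborel. f (z + axis j w) ^ k * dzbar j \<phi> (z + axis j w) * cauchy_kernel w) =
    - (of_real cauchy_const * (f z ^ k * \<phi> z))"
proof -
  define s where "s w = z + axis j w" for w
  define W where "W = {w. s w \<in> \<Omega>}"
  define S where "S = closure {x. \<phi> x \<noteq> 0}"
  define V where "V = {w. s w \<notin> S}"
  define F where "F w = f (s w) ^ k" for w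
  define u where "u w = F w * \<phi> (s w)" for w
  \<comment> \<open>Outside \<open>W\<close> the values of \<open>F\<close> and
    \<open>deriv F\<close> are arbitrary, but they are multiplied by a derivative or a value of
    \<open>\<phi>\<close> that is zero there.\<close>
  define u' where "u' w h = F w * frechet_derivative \<phi> (at (s w)) (axis j h) + deriv F w * h * \<phi> (s w)" for w h
  note S = test_functions_support[OF \<phi>, folded S_def]
  note \<phi>' = test_functions_has_derivative[OF \<phi>]
  have cs: "continuous_on A s" for A unfolding s_def by (rule continuous_on_axis)
  have oW: "open W" unfolding W_def
    using open_vimage[OF \<Omega>(1) cs] by (simp add: vimage_def)
  have oV: "open V" unfolding V_def
    using open_vimage[OF _ cs, of "- S"] compact_imp_closed[OF S(1)] by (auto simp: vimage_def)
  \<comment> \<open>Differentiability and continuity are checked on two open sets covering the line: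
    on \<open>W\<close> the factor \<open>F\<close> is holomorphic, on \<open>V\<close> everything
    vanishes.\<close>
  have WV: "W \<union> V = UNIV" using S(2) \<Omega>(2) by (auto simp: W_def V_def)
  have hF: "F holomorphic_on W"
    unfolding F_def s_def W_def by (intro holomorphic_intros holomorphic_multi_slice f)
  have V0: "u w = 0" "u' w h = 0" if "w \<in> V" for w h
    using that S(3,4) by (auto simp: u_def u'_def V_def)
  have du: "(u has_derivative u' w) (at w)" for w
  proof (cases "w \<in> W")
    case True
    have "(F has_field_derivative deriv F w) (at w)"
      using holomorphic_derivI[OF hF oW True] .
    moreover have "((\<lambda>w. \<phi> (s w)) has_derivative (\<lambda>h. frechet_derivative \<phi> (at (s w)) (axis j h))) (at w)"
      unfolding s_def by (rule has_derivative_compose[OF has_derivative_axis \<phi>'(1)])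
    ultimately show ?thesis
      unfolding u_def u'_def has_field_derivative_def by (rule has_derivative_mult)
  next
    case False
    then have "w \<in> V" using WV by auto
    moreover have "u' w = (\<lambda>_. 0)" using V0(2) \<open>w \<in> V\<close> by auto
    moreover have "((\<lambda>_. 0) has_derivative (\<lambda>_. 0)) (at w)" by simp
    ultimately show ?thesis
      using oV V0(1) by (metis has_derivative_transform_within_open)
  qed
  have cu: "continuous_on UNIV (\<lambda>w. u' w h)" for h
  proof -
    have cW: "continuous_on W (\<lambda>w. u' w h)"
    proof -
      have "continuous_on W F" "continuous_on W (deriv F)"
        using hF holomorphic_deriv[OF hF oW] holomorphic_on_imp_continuous_on by auto
      moreover have "continuous_on W (\<lambda>w. \<phi> (s w))" "continuous_on W (\<lambda>w. frechet_derivative \<phi> (at (s w)) (axis j h))"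
        using continuous_on_compose2[OF test_functions_continuous_on[OF \<phi>, of UNIV] cs]
          continuous_on_compose2[OF \<phi>'(2) cs] by auto
      ultimately show ?thesis unfolding u'_def by (intro continuous_intros)
    qed
    have "continuous_on V (\<lambda>w. u' w h)"
      using V0(2) by (simp cong: continuous_on_cong)
    then show ?thesis
      using continuous_on_open_Un[OF oW oV cW] WV by simp
  qed
  have u0: "u w = 0" if "w \<notin> cball 0 2" for w
  proof (rule ccontr)
    assume "u w \<noteq> 0"
    then have "s w \<in> unit_polydisc" using S(2,3) by (auto simp: u_def)
    then have "norm ((z + axis j w) $ j) < 1" unfolding unit_polydisc_def s_def by blast
    then have "norm (z $ j + w) < 1" by (simp add: axis_def)
    moreover have "norm (z $ j) < 1" using z by (simp add: unit_polydisc_def)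
    ultimately have "norm w < 2"
      using norm_triangle_ineq4[of "z $ j + w" "z $ j"] by simp
    with that show False by simp
  qed
  \<comment> \<open>The term with \<open>deriv F\<close> is complex linear in \<open>h\<close> and
    cancels, as \<open>1 + \<i> * \<i> = 0\<close>.\<close>
  have "(u' w 1 + \<i> * u' w \<i>) / 2 = f (z + axis j w) ^ k * dzbar j \<phi> (z + axis j w)" for w
    by (simp add: u'_def dzbar_def F_def s_def algebra_simps)
  moreover have "axis j 0 = (0 :: complex ^ 'n)" by (simp add: vec_eq_iff axis_def)
  moreover have "(LINT w|lborel. (u' w 1 + \<i> * u' w \<i>) / 2 * cauchy_kernel w) = - (of_real cauchy_const * u 0)"
    by (rule cauchy_pompeiu_compact_support[OF du cu u0])
  ultimately show ?thesis
    by (simp only: u_def F_def s_def add_0_right)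
qed

section \<open>The polydisc as a bounded open set\<close>

lemma open_unit_polydisc: "open (unit_polydisc :: (complex ^ 'n) set)"
  unfolding unit_polydisc_def Collect_all_eq
  by (intro open_INT ballI open_Collect_less continuous_intros) auto

lemma compact_closure_unit_polydisc: "compact (closure (unit_polydisc :: (complex ^ 'n) set))"
proof -
  have "norm z \<le> real CARD('n)" if "z \<in> unit_polydisc" for z :: "complex ^ 'n"
  proof -
    have "norm z \<le> (\<Sum>j\<in>UNIV. norm (z $ j))" by (simp add: norm_vec_def L2_set_le_sum)
    also have "\<dots> \<le> (\<Sum>j\<in>(UNIV :: 'n set). 1)"
      using that by (intro sum_mono) (auto simp: unit_polydisc_def less_imp_le)
    finally show ?thesis by simp
  qed
  then show ?thesis unfolding compact_closure bounded_iff by blast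
qed

subsection \<open>Solution of the equation\<close>

lemma integral_compact_support_restrict:
  fixes u :: "'a::euclidean_space \<Rightarrow> 'b::{banach, second_countable_topology}"
  assumes "U \<in> sets lebesgue" and "\<And>x. x \<notin> U \<Longrightarrow> u x = 0"
  shows "(LINT x|lebesgue_on U. u x) = (LINT x|lebesgue. u x)"
proof -
  have "(LINT x|lebesgue_on U. u x) = (LINT x|lebesgue. indicator U x *\<^sub>R u x)"
    using assms(1) by (intro integral_restrict_space) auto
  also have "(\<lambda>x. indicator U x *\<^sub>R u x) = u"
    using assms(2) by (auto simp: indicator_def fun_eq_iff)
  finally show ?thesis .
qed

text \<open>Continuity is asked on \<open>S\<close> only, since \<open>u\<close> will contain the
  factor \<open>f\<close>, about which nothing is known away from \<open>\<Omega>\<close>.\<close>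

lemma borel_measurable_continuous_compact_support:
  fixes u :: "'a::euclidean_space \<Rightarrow> complex"
  assumes "continuous_on S u" and "compact S" and "\<And>x. x \<notin> S \<Longrightarrow> u x = 0"
  shows "u \<in> borel_measurable borel"
proof -
  have "(\<lambda>x. indicator S x *\<^sub>R u x) \<in> borel_measurable borel"
    using assms by (intro borel_measurable_continuous_on_indicator) (auto simp: compact_imp_closed)
  also have "(\<lambda>x. indicator S x *\<^sub>R u x) = u"
    using assms(3) by (auto simp: indicator_def fun_eq_iff)
  finally show ?thesis .
qed

text \<open>The weak form of the equation for \<open>f ^ k\<close> times the normalised Cauchy
  transform of \<open>g\<close>. Transposing the convolution leaves, for each \<open>z\<close>,
  exactly the integral evaluated by \<open>cauchy_pompeiu_slice\<close>.\<close>

lemma integral_cauchy_slice_conv: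
  fixes f :: "complex ^ 'n \<Rightarrow> complex" and k :: nat
  assumes \<Omega>: "open \<Omega>" "unit_polydisc \<subseteq> \<Omega>" and f: "holomorphic_multi f \<Omega>"
    and \<phi>: "\<phi> \<in> test_functions unit_polydisc"
    and g: "integrable lborel g" and g0: "\<And>z. z \<notin> unit_polydisc \<Longrightarrow> g z = 0"
  shows "(LINT z|lebesgue_on unit_polydisc.
      f z ^ k * (slice_conv (axis j) cauchy_kernel g z / of_real cauchy_const) * dzbar j \<phi> z) =
    - (LINT z|lebesgue_on unit_polydisc. g z * (f z ^ k * \<phi> z))"
proof -
  define S where "S = closure {x. \<phi> x \<noteq> 0}"
  note S = test_functions_support[OF \<phi>, folded S_def]
  have D [simp]: "unit_polydisc \<in> sets lebesgue" by (intro sets_completionI_sets) (simp add: open_unit_polydisc)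
  have cf: "continuous_on S (\<lambda>z. f z ^ k)"
    using S(2) \<Omega>(2) by (intro continuous_intros continuous_on_subset[OF holomorphic_multi_continuous_on[OF f]]) auto
  have cd: "continuous_on S (dzbar j \<phi>)"
    unfolding dzbar_def
    by (intro continuous_intros continuous_on_subset[OF test_functions_has_derivative(2)[OF \<phi>]]) auto
  define \<Phi> where "\<Phi> z = f z ^ k * dzbar j \<phi> z" for z
  have \<Phi>0: "\<Phi> z = 0" if "z \<notin> S" for z using S(4) that by (simp add: \<Phi>_def dzbar_def)
  have \<Phi>c: "continuous_on S \<Phi>" unfolding \<Phi>_def by (intro continuous_intros cf cd)
  have \<Phi>m [measurable]: "\<Phi> \<in> borel_measurable borel"
    by (rule borel_measurable_continuous_compact_support[OF \<Phi>c S(1) \<Phi>0])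
  obtain C where C: "\<And>z. norm (\<Phi> z) \<le> C"
    using bounded_of_continuous_compact_support[OF \<Phi>c S(1) \<Phi>0] by metis
  define \<psi> where "\<psi> z = f z ^ k * \<phi> z" for z
  have \<psi>0: "\<psi> z = 0" if "z \<notin> S" for z using S(3) that by (simp add: \<psi>_def)
  have \<psi>m [measurable]: "\<psi> \<in> borel_measurable borel"
    by (rule borel_measurable_continuous_compact_support[OF _ S(1) \<psi>0])
      (auto simp: \<psi>_def intro!: continuous_intros cf test_functions_continuous_on[OF \<phi>])
  have gm [measurable]: "g \<in> borel_measurable borel" using g by auto
  let ?T = "slice_conv (axis j) cauchy_kernel g"
  have Tm [measurable]: "?T \<in> borel_measurable borel" by (rule slice_conv_measurable) measurable
  have "(LINT z|lebesgue_on unit_polydisc. f z ^ k * (?T z / of_real cauchy_const) * dzbar j \<phi> z) =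
      (LINT z|lebesgue_on unit_polydisc. ?T z * \<Phi> z / of_real cauchy_const)"
    by (simp add: \<Phi>_def mult_ac)
  also have "\<dots> = (LINT z|lebesgue. ?T z * \<Phi> z / of_real cauchy_const)"
    using S(2) \<Phi>0 by (intro integral_compact_support_restrict) auto
  also have "\<dots> = (LINT z|lborel. ?T z * \<Phi> z / of_real cauchy_const)"
    by (rule integral_completion) measurable
  also have "\<dots> = (LINT z|lborel. g z * (LINT w|lborel. \<Phi> (z + axis j w) * cauchy_kernel w)) / of_real cauchy_const"
    by (simp add: integral_slice_conv_mult[OF borel_measurable_axis g integrable_cauchy_kernel \<Phi>m C])
  also have "(LINT z|lborel. g z * (LINT w|lborel. \<Phi> (z + axis j w) * cauchy_kernel w)) =
      (LINT z|lborel. - (of_real cauchy_const * (g z * \<psi> z)))"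
  proof (rule Bochner_Integration.integral_cong[OF refl])
    fix z
    show "g z * (LINT w|lborel. \<Phi> (z + axis j w) * cauchy_kernel w) = - (of_real cauchy_const * (g z * \<psi> z))"
    \<comment> \<open>The slice formula is available only for \<open>z\<close> in the polydisc;
      elsewhere both sides are zero through \<open>g\<close>.\<close>
    proof (cases "z \<in> unit_polydisc")
      case True
      show ?thesis
        unfolding \<Phi>_def cauchy_pompeiu_slice[OF \<Omega> f \<phi> True] by (simp add: \<psi>_def)
    qed (simp add: g0)
  qed
  also have "\<dots> / of_real cauchy_const = - (LINT z|lborel. g z * \<psi> z)"
    using cauchy_const_nonzero by simp
  also have "(LINT z|lborel. g z * \<psi> z) = (LINT z|lebesgue. g z * \<psi> z)"
    by (rule integral_completion[symmetric]) measurable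
  also have "\<dots> = (LINT z|lebesgue_on unit_polydisc. g z * \<psi> z)"
    using S(2) \<psi>0 by (intro integral_compact_support_restrict[symmetric]) auto
  finally show ?thesis by (simp add: \<psi>_def)
qed

theorem theorem4p8:
  fixes r :: ennreal
    and f :: "(complex, 'n::{finite,linorder}) vec \<Rightarrow> complex"
    and \<Omega> Z :: "(complex, 'n) vec set"
    and \<omega> :: "(complex, 'n) vec \<Rightarrow> complex"
  assumes "1 \<le> r"
    and "open \<Omega>" and "closure unit_polydisc \<subseteq> \<Omega>"
    and "holomorphic_multi f \<Omega>"
    and "Z = {z \<in> \<Omega>. f z = 0}"
    and "Lrc r (unit_polydisc - Z) \<omega>"
  shows "\<forall>k::nat. \<exists>\<eta> :: 'n \<Rightarrow> (complex, 'n) vec \<Rightarrow> complex.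
           (\<forall>j. Lr r unit_polydisc (\<eta> j)) \<and>
           (\<forall>j. Lr r unit_polydisc (\<lambda>z. f z powi (- int k) * \<eta> j z)) \<and>
           card {j. \<not> Lrc r (unit_polydisc - Z) (\<eta> j)} \<le> 1 \<and>
           dbar_eq unit_polydisc \<eta> \<omega>"
proof
  fix k :: nat
  let ?D = "unit_polydisc :: (complex, 'n) vec set"
  define K where "K = ess_support \<omega>"
  have K: "compact K" "K \<subseteq> ?D - Z" and \<omega>: "Lr r UNIV \<omega>"
    using assms(6) by (auto simp: Lrc_def K_def)
  have \<omega>m: "\<omega> \<in> borel_measurable lebesgue" using \<omega> by (simp add: Lr_UNIV)
  have D\<Omega>: "?D \<subseteq> \<Omega>" using assms(3) closure_subset by blast
  have Dl [simp]: "?D \<in> sets lebesgue" by (intro sets_completionI_sets) (simp add: open_unit_polydisc)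
  have cf: "continuous_on \<Omega> f" by (rule holomorphic_multi_continuous_on[OF assms(4)])
  have fK: "f z \<noteq> 0" if "z \<in> K" for z using that K(2) D\<Omega> assms(5) by auto

  \<comment> \<open>The factor \<open>f\<^sup>-\<^sup>k\<close> cut off to the support of
    \<open>\<omega>\<close>. It is bounded since \<open>f\<close> has no zero on the compact set
    \<open>K\<close>, so \<open>q * \<omega>\<close> stays in the same Lebesgue space;
    \<open>g\<close> below represents it.\<close>
  define q where "q z = (if z \<in> K then inverse (f z ^ k) else 0)" for z
  have "continuous_on K (\<lambda>z. inverse (f z ^ k))"
    using K(2) D\<Omega> fK by (intro continuous_intros continuous_on_subset[OF cf]) auto
  then have qc: "continuous_on K q" unfolding q_def by (simp cong: continuous_on_cong)
  have q0: "q z = 0" if "z \<notin> K" for z using that by (simp add: q_def)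
  have qm: "q \<in> borel_measurable borel"
    by (rule borel_measurable_continuous_compact_support[OF qc K(1) q0])
  then have ql: "q \<in> borel_measurable lebesgue" by (intro measurable_completion) simp
  obtain B where B: "0 \<le> B" "\<And>z. norm (q z) \<le> B"
    using bounded_of_continuous_compact_support[OF qc K(1) q0] by metis
  have Lq: "Lr r UNIV (\<lambda>z. q z * \<omega> z)"
  proof (rule Lr_dominated[OF \<omega> _ B(1)])
    show "(\<lambda>z. q z * \<omega> z) \<in> borel_measurable (lebesgue_on UNIV)"
      unfolding lebesgue_on_UNIV_eq using ql \<omega>m by measurable
    show "AE z in lebesgue_on UNIV. norm (q z * \<omega> z) \<le> B * norm (\<omega> z)"
      unfolding norm_mult by (intro AE_I2 mult_right_mono B) simp
  qed
  have "AE z in lebesgue. z \<notin> K \<longrightarrow> q z * \<omega> z = 0" by (simp add: q0)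
  then obtain g where gm: "g \<in> borel_measurable borel" and gae: "AE z in lebesgue. g z = q z * \<omega> z"
    and g0: "\<And>z. z \<notin> K \<Longrightarrow> g z = 0" and gi: "integrable lborel g"
    and gr: "if r = \<infinity> then \<exists>C. \<forall>x. norm (g x) \<le> C else integrable lborel (\<lambda>x. norm (g x) powr enn2real r)"
    by (rule Lr_compact_support_borel_representative[OF assms(1) Lq K(1)]) blast

  \<comment> \<open>For the first index no \<open>i\<close> precedes \<open>j\<close>, so the sign
    in \<open>dbar\<close> is 1.\<close>
  define j where "j = (Min UNIV :: 'n)"
  have j0: "{i. i < j} = {}" unfolding j_def by (auto simp: not_less)
  define T where "T z = slice_conv (axis j) cauchy_kernel g z / of_real cauchy_const" for z
  have "slice_conv (axis j) cauchy_kernel g \<in> borel_measurable borel"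
    using slice_conv_measurable[OF borel_measurable_axis gm] by simp
  then have Tm0: "T \<in> borel_measurable borel" unfolding T_def by measurable
  then have Tm: "T \<in> borel_measurable lebesgue" by (intro measurable_completion) simp
  have "Lr r UNIV T"
  proof (rule Lr_dominated)
    show "Lr r UNIV (slice_conv (axis j) cauchy_kernel g)"
      by (rule Lr_slice_conv[OF assms(1) borel_measurable_axis integrable_cauchy_kernel gm gr])
    show "T \<in> borel_measurable (lebesgue_on UNIV)" using Tm by (simp only: lebesgue_on_UNIV_eq)
    show "AE z in lebesgue_on UNIV. norm (T z) \<le> (1 / \<bar>cauchy_const\<bar>) * norm (slice_conv (axis j) cauchy_kernel g z)"
      by (intro AE_I2) (simp add: T_def norm_divide)
  qed simp
  then have LT: "Lr r ?D T" by (rule Lr_subset) simp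
  have TmD [measurable]: "T \<in> borel_measurable (lebesgue_on ?D)" using LT by (simp add: Lr_def)
  have fmD [measurable]: "f \<in> borel_measurable (lebesgue_on ?D)"
    by (intro continuous_imp_measurable_on_sets_lebesgue continuous_on_subset[OF cf D\<Omega>]) simp

  define \<eta> where "\<eta> i z = (if i = j then f z ^ k * T z else 0)" for i z
  have \<eta>j: "\<eta> j = (\<lambda>z. f z ^ k * T z)" and \<eta>0: "\<And>i. i \<noteq> j \<Longrightarrow> \<eta> i = (\<lambda>_. 0)"
    by (auto simp: \<eta>_def)
  have "Lr r ?D (\<lambda>z. f z ^ k * T z)"
  proof -
    \<comment> \<open>Holomorphy near the closed polydisc enters here: \<open>f\<close> is bounded
      on a compact set, so multiplication by \<open>f ^ k\<close> preserves
      \<open>Lr\<close>.\<close>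
    have "bounded (f ` closure ?D)"
      by (intro compact_imp_bounded compact_continuous_image continuous_on_subset[OF cf assms(3)]
          compact_closure_unit_polydisc)
    then obtain C where C: "\<And>z. z \<in> closure ?D \<Longrightarrow> norm (f z) \<le> C" by (auto simp: bounded_iff)
    then have C': "norm (f z) \<le> C" if "z \<in> ?D" for z using that closure_subset by blast
    have "0 \<in> ?D" by (simp add: unit_polydisc_def)
    then have "0 \<le> C" using C' norm_ge_zero order_trans by blast
    then show ?thesis using C'
      by (intro Lr_dominated[OF LT, of _ "C ^ k"] AE_I2)
        (auto simp: norm_mult norm_power intro!: mult_right_mono power_mono)
  qed
  then have 1: "Lr r ?D (\<eta> i)" for i
    by (cases "i = j") (auto simp: \<eta>j \<eta>0 Lr_zero)
  have "Lr r ?D (\<lambda>z. f z powi (- int k) * (f z ^ k * T z))"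
  proof (rule Lr_dominated[OF LT, of _ 1])
    show "(\<lambda>z. f z powi (- int k) * (f z ^ k * T z)) \<in> borel_measurable (lebesgue_on ?D)"
      unfolding power_int_minus power_int_of_nat by measurable
    show "AE z in lebesgue_on ?D. norm (f z powi (- int k) * (f z ^ k * T z)) \<le> 1 * norm (T z)"
    proof (rule AE_I2)
      fix z
      \<comment> \<open>For \<open>a = f z ^ k\<close>: where \<open>a\<close> is 0 the product is
        0, as \<open>inverse 0 = 0\<close>, and elsewhere it equals \<open>b\<close>. The inequality
        covers both cases, even if \<open>Z\<close> has positive measure.\<close>
      have "norm (inverse a * (a * b)) \<le> norm b" for a b :: complex
        by (cases "a = 0") (simp_all flip: mult.assoc)
      then show "norm (f z powi (- int k) * (f z ^ k * T z)) \<le> 1 * norm (T z)"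
        unfolding power_int_minus power_int_of_nat by simp
    qed
  qed simp
  then have 2: "Lr r ?D (\<lambda>z. f z powi (- int k) * \<eta> i z)" for i
    by (cases "i = j") (auto simp: \<eta>j \<eta>0 Lr_zero)
  have "{i. \<not> Lrc r (?D - Z) (\<eta> i)} \<subseteq> {j}"
    using \<eta>0 Lrc_zero by (metis (mono_tags, lifting) mem_Collect_eq singletonI subsetI)
  then have 3: "card {i. \<not> Lrc r (?D - Z) (\<eta> i)} \<le> 1"
    using card_mono[of "{j}"] by fastforce
  have 4: "dbar_eq ?D \<eta> \<omega>"
    unfolding dbar_eq_def
  proof
    fix \<phi> assume \<phi>: "\<phi> \<in> test_functions ?D"
    have "dbar ?D \<eta> \<phi> = (\<Sum>i\<in>{j}. (-1) ^ card {i'. i' < i} * distr_dzbar i (distr_of ?D (\<eta> i)) \<phi>)"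
      unfolding dbar_def by (rule sum.mono_neutral_right) (auto simp: \<eta>0 distr_dzbar_def distr_of_def)
    also have "\<dots> = - (LINT z|lebesgue_on ?D. f z ^ k * T z * dzbar j \<phi> z)"
      by (simp add: j0 distr_dzbar_def distr_of_def \<eta>j)
    also have "\<dots> = (LINT z|lebesgue_on ?D. g z * (f z ^ k * \<phi> z))"
      unfolding T_def
      by (subst integral_cauchy_slice_conv[OF assms(2) D\<Omega> assms(4) \<phi> gi]) (use g0 K(2) in auto)
    also have "\<dots> = (LINT z|lebesgue_on ?D. \<omega> z * \<phi> z)"
    proof (rule integral_cong_AE)
      have \<phi>m [measurable]: "\<phi> \<in> borel_measurable (lebesgue_on ?D)"
        by (intro continuous_imp_measurable_on_sets_lebesgue test_functions_continuous_on[OF \<phi>]) simp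
      have [measurable]: "g \<in> borel_measurable (lebesgue_on ?D)" "\<omega> \<in> borel_measurable (lebesgue_on ?D)"
        using gm \<omega>m by (auto intro!: measurable_restrict_space1 measurable_completion)
      show "(\<lambda>z. g z * (f z ^ k * \<phi> z)) \<in> borel_measurable (lebesgue_on ?D)"
        "(\<lambda>z. \<omega> z * \<phi> z) \<in> borel_measurable (lebesgue_on ?D)" by measurable
      \<comment> \<open>On \<open>K\<close> the factor \<open>f z ^ k\<close> cancels
        \<open>q z\<close>; off \<open>K\<close> the factor \<open>q z\<close> is zero and
        \<open>\<omega>\<close> vanishes almost everywhere.\<close>
      have "AE z in lebesgue. g z * (f z ^ k * \<phi> z) = \<omega> z * \<phi> z"
        using gae AE_eq_0_outside_ess_support[of \<omega>]
      proof eventually_elim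
        case (elim z)
        then show ?case using fK[of z] by (cases "z \<in> K") (auto simp: q_def K_def)
      qed
      then show "AE z in lebesgue_on ?D. g z * (f z ^ k * \<phi> z) = \<omega> z * \<phi> z"
        by (subst AE_restrict_space_iff) auto
    qed
    finally show "dbar ?D \<eta> \<phi> = distr_of ?D \<omega> \<phi>" by (simp add: distr_of_def)
  qed
  show "\<exists>\<eta> :: 'n \<Rightarrow> (complex, 'n) vec \<Rightarrow> complex.
           (\<forall>j. Lr r unit_polydisc (\<eta> j)) \<and>
           (\<forall>j. Lr r unit_polydisc (\<lambda>z. f z powi (- int k) * \<eta> j z)) \<and>
           card {j. \<not> Lrc r (unit_polydisc - Z) (\<eta> j)} \<le> 1 \<and>
           dbar_eq unit_polydisc \<eta> \<omega>"
    using 1 2 3 4 by blast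
qed

end
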